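(* Let $0<k<n$ and write $e_i=e_i(z)$. (a) The ring $\widetilde{\mathrm{QK}}_T(\mathrm{Gr}(k;n))$ is isomorphic to $\mathrm K_T(pt)[[q]][e_1,\dots,e_k]/\widetilde I$, where the ideal $\widetilde I$ is defined by the relations $\tilde R=EH'+E^\zeta_{n-k+1}$, i.e. $$\begin{pmatrix}\tilde g_{n-k+1}\\ \tilde g_{n-k+2}\\ \vdots\\ \tilde g_n\end{pmatrix}=\begin{pmatrix}-1&0&\dots&0\\-e_1&-1&\dots&0\\ \vdots&\vdots&\ddots&0\\-e_{k-1}&-e_{k-2}&\dots&-1\end{pmatrix}\begin{pmatrix}(-1)^{n-k+1}h'_{n-k+1}\\(-1)^{n-k+2}h'_{n-k+2}\\ \vdots\\(-1)^nh'_n\end{pmatrix}+\begin{pmatrix}e_{n-k+1}(\zeta)\\ \vdots\\ \vdots\\ e_n(\zeta)\end{pmatrix}.$$ (b) The ring $\widehat{\mathrm{QK}}_T(\mathrm{Gr}(k;n))$ is isomorphic to $\mathrm K_T(pt)[[q]][e_1,\dots,e_k]/\widehat I$, where the ideal $\widehat I$ is defined by the relations $\hat R=EG'+C^{z,\zeta}_{\ge n-k+1}$, i.e. $$\begin{pmatrix}\hat g_{n-k+1}\\ \hat g_{n-k+2}\\ \vdots\\ \hat g_n\end{pmatrix}=\begin{pmatrix}-1&0&\dots&0\\-e_1&-1&\dots&0\\ \vdots&\vdots&\ddots&0\\-e_{k-1}&-e_{k-2}&\dots&-1\end{pmatrix}\begin{pmatrix}(-1)^{n-k+1}G'_{n-k+1}\\(-1)^{n-k+2}G'_{n-k+2}\\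 \vdots\\(-1)^nG'_n\end{pmatrix}+\begin{pmatrix}c'_{\ge n-k+1}\\ \vdots\\ \vdots\\ c'_{\ge n}\end{pmatrix}.$$
   Context: $\mathrm K_T(pt)=\mathbb Z[T_1^{\pm1},\dots,T_n^{\pm1}]$, $\zeta_i=1-T_i$, $\zeta=(\zeta_1,\dots,\zeta_n)$; $z=(z_1,\dots,z_k)$, $\hat z=(\hat z_1,\dots,\hat z_{n-k})$, $\tilde z=(\tilde z_1,\dots,\tilde z_{n-k})$ are formal variables. $e_i$, $h_i$, $s_\mu$ denote elementary symmetric, complete homogeneous symmetric and Schur polynomials ($e_0=h_0=1$; $e_i=0$ for $i<0$ or $i$ exceeding the number of variables). Grothendieck polynomials: $G_0(z)=1$ and, for $j\ge1$, $G_j(z)=h_j(z)-\sum_{a=2}^k(-1)^as_{(j,1^{a-1})}(z)$. Equivariant versions: $h'_j(z,\zeta)=\sum_{a+b=j}(-1)^ae_a(\zeta)h_b(z)$ and $G'_j(z,\zeta)=\sum_{a+b=j}(-1)^ae_a(\zeta)G_b(z)$. Set $c^z_{\ge j}=\sum_{i\ge j}(-1)^{i-j}e_i(z)$, $c^\zeta_{\ge j}=\sum_{i\ge j}(-1)^{i-j}e_i(\zeta)$, $c^\zeta=\prod_{i=1}^n(1-\zeta_i)$, and $c'_{\ge\ell}=c'_{\ge\ell}(z,\zeta)=e_\ell(\zeta)+e_{\ell-1}(\zeta)c^z_{\ge2}+\dots+e_{\ell-k+1}(\zeta)c^z_{\ge k}$. Let $E$ be the $k\times k$ lower triangular matrix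 with $E_{ij}=-e_{i-j}(z)$ for $i\ge j$, and $C^\zeta_{\ge n-k+2}=(c^\zeta_{\ge n-k+2},\dots,c^\zeta_{\ge n},0)^t$. Define $\hat g_\ell=c'_{\ge\ell}$ for $1\le\ell\le n-k$, and $\hat g_\ell=c'_{\ge\ell}+(E\cdot C^\zeta_{\ge n-k+2})_{\ell-n+k}+(-1)^{n+k}q\binom{k-1}{n-\ell}c^\zeta$ for $n-k+1\le\ell\le n$. Define $$\tilde g_\ell=e_\ell(\zeta)+(-1)^{n-k}\tfrac{q}{1-q}\,e_{n-k}(1-\tilde z)\Big(\tbinom{k}{\ell+k-n}-e_{\ell+k-n}(z)\Big),\qquad e_{n-k}(1-\tilde z)=\prod_{j}(1-\tilde z_j)=\sum_{j=0}^{n-k}(-1)^je_j(\tilde z),$$ with $\binom km=0$ for $m<0$. The rings are $$\widehat{\mathrm{QK}}_T(\mathrm{Gr}(k;n))=\mathrm K_T(pt)[[q]][e_1(z),\dots,e_k(z),e_1(\hat z),\dots,e_{n-k}(\hat z)]/\langle\textstyle\sum_{i+j=\ell}e_i(z)e_j(\hat z)-\hat g_\ell\rangle_{1\le\ell\le n},$$ $$\widetilde{\mathrm{QK}}_T(\mathrm{Gr}(k;n))=\mathrm K_T(pt)[[q]][e_1(z),\dots,e_k(z),e_1(\tilde z),\dots,e_{n-k}(\tilde z)]/\langle\textstyle\sum_{i+j=\ell}e_i(z)e_j(\tilde z)-\tilde g_\ell\rangle_{1\le\ell\le n},$$ where the $e_i(z)$, $e_j(\hat z)$, $e_j(\tilde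 z)$ are algebraically independent. In part (a), the $\tilde g_\ell$ are regarded as elements of $\mathrm K_T(pt)[[q]][e_1,\dots,e_k]$ by substituting $e_j(\tilde z)=(-1)^jh'_j(z,\zeta)$ for $1\le j\le n-k$, i.e. $e_{n-k}(1-\tilde z)$ is replaced by $\sum_{j=0}^{n-k}h'_j(z,\zeta)$. An ideal "defined by" a vector equality is the ideal generated by the differences of corresponding entries. *)

theory Defs
  imports
    "HOL-Library.Poly_Mapping"
    "HOL-Library.Multiset"
    "HOL-Library.FuncSet"
    "HOL-Computational_Algebra.Formal_Power_Series"
    "HOL-Algebra.QuotRing"
    "HOL-Algebra.Generated_Rings"
    "HOL-Decision_Procs.Algebra_Aux"
begin

text \<open>The degree of \<open>esym\<close> is an integer, so that it vanishes for negative degrees and for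
  degrees exceeding \<open>m\<close>.\<close>

definition esym :: "nat \<Rightarrow> (nat \<Rightarrow> 'a::comm_ring_1) \<Rightarrow> int \<Rightarrow> 'a" where
  "esym m x d = (\<Sum>S | S \<subseteq> {1..m} \<and> int (card S) = d. \<Prod>i\<in>S. x i)"

definition hsym :: "nat \<Rightarrow> (nat \<Rightarrow> 'a::comm_ring_1) \<Rightarrow> nat \<Rightarrow> 'a" where
  "hsym m x d = (\<Sum>M | set_mset M \<subseteq> {1..m} \<and> size M = d. \<Prod>i\<in>#M. x i)"

text \<open>A partition is given by the list of its parts. The cells of its Young diagram are pairs
  (row, column), counted from 0; a semistandard tableau is a filling that weakly increases along
  rows and strictly increases down columns.\<close>

definition young_diagram :: "nat list \<Rightarrow> (nat \<times> nat) set" where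
  "young_diagram \<mu> = {(r, c). r < length \<mu> \<and> c < \<mu> ! r}"

definition ssyt :: "nat \<Rightarrow> nat list \<Rightarrow> (nat \<times> nat \<Rightarrow> nat) set" where
  "ssyt m \<mu> = {t \<in> young_diagram \<mu> \<rightarrow>\<^sub>E {1..m}.
     (\<forall>r c. (r, c) \<in> young_diagram \<mu> \<and> (r, Suc c) \<in> young_diagram \<mu> \<longrightarrow> t (r, c) \<le> t (r, Suc c)) \<and>
     (\<forall>r c. (r, c) \<in> young_diagram \<mu> \<and> (Suc r, c) \<in> young_diagram \<mu> \<longrightarrow> t (r, c) < t (Suc r, c))}"

definition schur :: "nat \<Rightarrow> (nat \<Rightarrow> 'a::comm_ring_1) \<Rightarrow> nat list \<Rightarrow> 'a" where
  "schur m x \<mu> = (\<Sum>t\<in>ssyt m \<mu>. \<Prod>p\<in>young_diagram \<mu>. x (t p))"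

definition grothendieck :: "nat \<Rightarrow> (nat \<Rightarrow> 'a::comm_ring_1) \<Rightarrow> nat \<Rightarrow> 'a" where
  "grothendieck m x j =
     (if j = 0 then 1
      else hsym m x j - (\<Sum>a=2..m. (-1) ^ a * schur m x (j # replicate (a - 1) 1)))"

text \<open>The terms with \<open>i > m\<close> vanish, so the sum over all \<open>i \<ge> j\<close> stops at \<open>m\<close>.\<close>

definition c_ge :: "nat \<Rightarrow> (nat \<Rightarrow> 'a::comm_ring_1) \<Rightarrow> nat \<Rightarrow> 'a" where
  "c_ge m x j = (\<Sum>i=j..m. (-1) ^ (i - j) * esym m x (int i))"

text \<open>A Laurent polynomial over the integers maps finitely many integer exponent vectors to
  nonzero coefficients; \<open>KT n\<close> consists of those in which only the variables with index
  in \<open>{1..n}\<close> occur.\<close>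

type_synonym laurent = "(nat \<Rightarrow>\<^sub>0 int) \<Rightarrow>\<^sub>0 int"

definition KT :: "nat \<Rightarrow> laurent set" where
  "KT n = {f. \<forall>m \<in> Poly_Mapping.keys f. Poly_Mapping.keys m \<subseteq> {1..n}}"

definition T :: "nat \<Rightarrow> laurent" where
  "T i = Poly_Mapping.single (Poly_Mapping.single i 1) 1"

definition KTq :: "nat \<Rightarrow> laurent fps set" where
  "KTq n = {f. \<forall>d. fps_nth f d \<in> KT n}"

text \<open>\<open>Z i\<close> stands for $z_i$ and \<open>W j\<close> for $\hat z_j$ or $\tilde z_j$, according to
  the ring under consideration.\<close>

datatype var = Z nat | W nat

type_synonym pol = "(var \<Rightarrow>\<^sub>0 nat) \<Rightarrow>\<^sub>0 laurent fps"

definition const :: "laurent fps \<Rightarrow> pol" where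
  "const c = Poly_Mapping.single 0 c"

definition pvar :: "var \<Rightarrow> pol" where
  "pvar v = Poly_Mapping.single (Poly_Mapping.single v 1) 1"

abbreviation z :: "nat \<Rightarrow> pol" where "z i \<equiv> pvar (Z i)"
abbreviation w :: "nat \<Rightarrow> pol" where "w j \<equiv> pvar (W j)"

definition \<zeta> :: "nat \<Rightarrow> pol" where
  "\<zeta> i = const (fps_const (1 - T i))"

definition q :: pol where
  "q = const fps_X"

text \<open>The power series $q/(1-q)$; there is no division for series over a general ring.\<close>

definition q_over_one_minus_q :: pol where
  "q_over_one_minus_q = const (fps_X * Abs_fps (\<lambda>_. 1))"

lemma const_mult: "const a * const b = const (a * b)"
  by (simp add: const_def Poly_Mapping.mult_single)

lemma q_over_one_minus_q: "(1 - q) * q_over_one_minus_q = q"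
proof -
  have 1: "(1 - fps_X) * Abs_fps (\<lambda>_. 1::laurent) = 1"
    by (rule fps_ext) (simp add: algebra_simps fps_X_mult_nth)
  have "1 - q = const (1 - fps_X)"
    by (simp add: q_def const_def single_diff single_one)
  then have "(1 - q) * q_over_one_minus_q = const (fps_X * ((1 - fps_X) * Abs_fps (\<lambda>_. 1)))"
    by (simp add: q_over_one_minus_q_def const_mult ac_simps)
  then show ?thesis by (simp only: 1 q_def mult_1_right)
qed

text \<open>The algebra over \<open>KTq n\<close> generated by a set of polynomials. The elementary symmetric
  polynomials in \<open>z\<close> and in \<open>w\<close> being algebraically independent, adjoining them yields
  a polynomial ring.\<close>

definition adjoin :: "nat \<Rightarrow> pol set \<Rightarrow> pol ring" where
  "adjoin n S = cring_class_ops
     \<lparr>carrier := generate_ring cring_class_ops (const ` KTq n \<union> S)\<rparr>"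

definition sym_z :: "nat \<Rightarrow> nat \<Rightarrow> pol ring" where
  "sym_z n k = adjoin n {esym k z (int i) | i. i \<in> {1..k}}"

definition sym_zw :: "nat \<Rightarrow> nat \<Rightarrow> pol ring" where
  "sym_zw n k = adjoin n
     ({esym k z (int i) | i. i \<in> {1..k}} \<union> {esym (n - k) w (int j) | j. j \<in> {1..n - k}})"

definition ring_mod :: "pol ring \<Rightarrow> pol set \<Rightarrow> pol set ring" where
  "ring_mod R S = R Quot (Idl\<^bsub>R\<^esub> S)"

definition h' :: "nat \<Rightarrow> nat \<Rightarrow> nat \<Rightarrow> pol" where
  "h' n k j = (\<Sum>a=0..j. (-1) ^ a * esym n \<zeta> (int a) * hsym k z (j - a))"

definition G' :: "nat \<Rightarrow> nat \<Rightarrow> nat \<Rightarrow> pol" where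
  "G' n k j = (\<Sum>a=0..j. (-1) ^ a * esym n \<zeta> (int a) * grothendieck k z (j - a))"

definition c' :: "nat \<Rightarrow> nat \<Rightarrow> nat \<Rightarrow> pol" where
  "c' n k l = esym n \<zeta> (int l) + (\<Sum>s=2..k. esym n \<zeta> (int l - int s + 1) * c_ge k z s)"

text \<open>Matrices and vectors are indexed from 1.\<close>

definition E :: "nat \<Rightarrow> nat \<Rightarrow> nat \<Rightarrow> pol" where
  "E k i j = (if i \<ge> j then - esym k z (int i - int j) else 0)"

definition mat_vec :: "nat \<Rightarrow> (nat \<Rightarrow> nat \<Rightarrow> pol) \<Rightarrow> (nat \<Rightarrow> pol) \<Rightarrow> nat \<Rightarrow> pol" where
  "mat_vec k A v i = (\<Sum>j=1..k. A i j * v j)"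

definition C_zeta :: "nat \<Rightarrow> nat \<Rightarrow> nat \<Rightarrow> pol" where
  "C_zeta n k i = (if i < k then c_ge n \<zeta> (n - k + 1 + i) else 0)"

definition g_hat :: "nat \<Rightarrow> nat \<Rightarrow> nat \<Rightarrow> pol" where
  "g_hat n k l =
     (if l \<le> n - k then c' n k l
      else c' n k l + mat_vec k (E k) (C_zeta n k) (l - (n - k))
           + (-1) ^ (n + k) * q * of_nat ((k - 1) choose (n - l)) * (\<Prod>i=1..n. 1 - \<zeta> i))"

text \<open>The argument \<open>u\<close> takes the place of $e_{n-k}(1-\tilde z)$.\<close>

definition g_tilde :: "nat \<Rightarrow> nat \<Rightarrow> pol \<Rightarrow> nat \<Rightarrow> pol" where
  "g_tilde n k u l = esym n \<zeta> (int l)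
     + (-1) ^ (n - k) * q_over_one_minus_q * u *
       ((if l + k < n then 0 else of_nat (k choose (l + k - n)))
        - esym k z (int l + int k - int n))"

definition QK_hat :: "nat \<Rightarrow> nat \<Rightarrow> pol set ring" where
  "QK_hat n k = ring_mod (sym_zw n k)
     {(\<Sum>i=0..l. esym k z (int i) * esym (n - k) w (int (l - i))) - g_hat n k l | l. l \<in> {1..n}}"

definition QK_tilde :: "nat \<Rightarrow> nat \<Rightarrow> pol set ring" where
  "QK_tilde n k = ring_mod (sym_zw n k)
     {(\<Sum>i=0..l. esym k z (int i) * esym (n - k) w (int (l - i)))
      - g_tilde n k (esym (n - k) (\<lambda>j. 1 - w j) (int (n - k))) l | l. l \<in> {1..n}}"

end

theory Submission
  imports Defs "HOL-Computational_Algebra.Fraction_Field" "HOL-Algebra.Algebraic_Closure_Type"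
begin

text \<open>
  Both quotient rings are simplified in the same way: the first \<open>n - k\<close> relations determine
  the elementary symmetric polynomials in \<open>w\<close>, and eliminating these leaves the last \<open>k\<close>
  relations.

  For \<open>l \<le> n - k\<close> the right-hand side of the \<open>l\<close>-th relation is \<open>c\<^sub>l\<close>, where \<open>c\<^sub>l = e\<^sub>l(\<zeta>)\<close> in the
  first ring and \<open>c\<^sub>l = c' n k l\<close> in the second. It contains no \<open>w\<close>, and \<open>e\<^sub>0(z) = 1\<close>, so the relations
  \<open>\<Sum>\<^sub>i e\<^sub>i(z) e\<^bsub>l-i\<^esub>(w) = c\<^sub>l\<close> can be solved recursively for the \<open>e\<^sub>j(w)\<close>. The solution is the sequence
  \<open>P\<close> with \<open>\<Sum>\<^sub>i e\<^sub>i(z) P\<^bsub>l-i\<^esub> = c\<^sub>l\<close>, namely \<open>P\<^sub>j = (-1)\<^sup>j h'\<^sub>j\<close> in the first ring and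
  \<open>P\<^sub>j = (-1)\<^sup>j G'\<^sub>j\<close> in the second (\<open>esym_h'_convolution\<close>, \<open>esym_G'_convolution\<close>). These identities
  hold for every \<open>l\<close>, not only for \<open>l \<le> n - k\<close>. As \<open>e\<^sub>j(w) = 0\<close> for \<open>j > n - k\<close>, substituting \<open>P\<^sub>j\<close> for
  \<open>e\<^sub>j(w)\<close> in the convolution of degree \<open>l = n - k + i\<close> therefore gives \<open>c\<^sub>l\<close> minus the terms
  \<open>e\<^bsub>l-j\<^esub>(z) P\<^sub>j\<close> with \<open>n - k < j \<le> l\<close>. The entries of \<open>E\<close> carry the sign, so this is \<open>c\<^sub>l\<close> plus the
  \<open>i\<close>-th entry of the product of \<open>E\<close> with the vector of the \<open>P\<^bsub>n-k+s\<^esub>\<close> (\<open>truncated_convolution\<close>).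

  Turning this into an isomorphism needs a ring homomorphism \<open>\<phi>\<close> that fixes the symmetric
  polynomials in \<open>z\<close> and sends \<open>e\<^sub>j(w)\<close> to \<open>P\<^sub>j\<close> (\<open>exists_specialisation\<close>). Its existence expresses the
  algebraic independence of the \<open>e\<^sub>j(w)\<close>. It is obtained here by an actual substitution for the
  variables \<open>w\<close>: over the algebraic closure of the fraction field of the polynomial ring, the
  polynomial \<open>\<Sum>\<^sub>j (-1)\<^sup>j P\<^sub>j X\<^bsup>n-k-j\<^esup>\<close> splits, and its roots have the \<open>P\<^sub>j\<close> as elementary
  symmetric functions. Substituting these roots for the \<open>w\<close> is a homomorphism, which maps the
  subring of polynomials symmetric in \<open>z\<close> and in \<open>w\<close> into the subring of those in \<open>z\<close>. Since \<open>\<phi>\<close> is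
  a retraction and \<open>f - \<phi> f\<close> always lies in the ideal of relations, the first isomorphism theorem
  applies (\<open>quotient_iso_of_retraction\<close>, \<open>eliminate_w_variables\<close>).

  The identity for \<open>G'\<close> rests on the Pieri rule for hooks,
  \<open>h\<^sub>j e\<^bsub>b+1\<^esub> = s\<^bsub>(j,1^(b+1))\<^esub> + s\<^bsub>(j+1,1^b)\<^esub>\<close> (\<open>hsym_times_esym_hooks\<close>): it gives the relation of
  \<open>e\<close> and \<open>h\<close> by telescoping, and the recursion \<open>G\<^bsub>j+1\<^esub> = G\<^sub>j - (\<Prod>\<^sub>i (1 - z\<^sub>i)) h\<^sub>j\<close>
  (\<open>grothendieck_Suc\<close>), from which the convolution of \<open>e\<close> and \<open>G\<close> follows by induction.
\<close>

section \<open>Elementary symmetric polynomials\<close>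

lemma esym_nat:
  "esym m x (int d) = (\<Sum>S | S \<subseteq> {1..m} \<and> card S = d. \<Prod>i\<in>S. x i)"
  by (simp add: esym_def)

lemma esym_0 [simp]: "esym m x 0 = 1"
proof -
  have "{S. S \<subseteq> {1..m} \<and> int (card S) = 0} = {{}}"
    by (auto dest: finite_subset)
  then show ?thesis by (simp add: esym_def)
qed

lemma esym_neg [simp]: "d < 0 \<Longrightarrow> esym m x d = 0"
  by (simp add: esym_def)

lemma esym_above:
  assumes "int m < d"
  shows "esym m x d = 0"
proof -
  have "int (card S) \<noteq> d" if "S \<subseteq> {1..m}" for S
    using card_mono[OF _ that] assms by simp
  then have "{S. S \<subseteq> {1..m} \<and> int (card S) = d} = {}" by blast
  then show ?thesis unfolding esym_def by (simp only: sum.empty)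
qed

text \<open>The homogeneous form serves two purposes: \<open>y = 1\<close>, \<open>u = -1\<close> gives the alternating sum of
  the elementary symmetric polynomials, and \<open>y = X\<close>, \<open>u = -1\<close> gives the formula of Vieta.\<close>
lemma prod_add_esym:
  "(\<Prod>i=1..m. y + u * x i) = (\<Sum>j=0..m. esym m x (int j) * u ^ j * y ^ (m - j))"
proof -
  have "(\<Prod>i=1..m. y + u * x i) = (\<Prod>i=1..m. u * x i + y)"
    by (simp add: add.commute)
  also have "\<dots> = (\<Sum>S\<in>Pow {1..m}. (\<Prod>i\<in>S. u * x i) * (\<Prod>i\<in>{1..m} - S. y))"
    by (rule prod_add) simp
  also have "\<dots> = (\<Sum>S\<in>Pow {1..m}. (\<Prod>i\<in>S. x i) * u ^ card S * y ^ (m - card S))"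
    by (rule sum.cong) (auto simp: prod.distrib card_Diff_subset finite_subset mult_ac)
  also have "\<dots> = (\<Sum>j\<in>{0..m}. \<Sum>S | S \<in> Pow {1..m} \<and> card S = j.
      (\<Prod>i\<in>S. x i) * u ^ card S * y ^ (m - card S))"
  proof (rule sum.group[symmetric])
    show "card ` Pow {1..m} \<subseteq> {0..m}"
      using card_mono[of "{1..m}"] by force
  qed auto
  also have "\<dots> = (\<Sum>j=0..m. esym m x (int j) * u ^ j * y ^ (m - j))"
    by (rule sum.cong) (auto simp: esym_nat sum_distrib_right intro!: sum.cong)
  finally show ?thesis .
qed

lemma esym_top: "esym m x (int m) = (\<Prod>i=1..m. x i)"
proof -
  have "S = {1..m}" if "S \<subseteq> {1..m}" "card S = m" for S
    using that by (intro card_subset_eq) auto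
  then have "{S. S \<subseteq> {1..m} \<and> card S = m} = {{1..m}}" by auto
  then show ?thesis by (simp add: esym_nat)
qed

lemma prod_one_minus_eq_sum_esym:
  "(\<Prod>i=1..m. 1 - x i) = (\<Sum>j=0..m. (-1) ^ j * esym m x (int j))"
  using prod_add_esym[where m = m and y = 1 and u = "- 1" and x = x] by (simp add: mult_ac)

section \<open>The Pieri rule for hooks\<close>

definition mset_set_pairs :: "nat \<Rightarrow> nat \<Rightarrow> nat \<Rightarrow> (nat multiset \<times> nat set) set" where
  "mset_set_pairs m j b = {M. set_mset M \<subseteq> {1..m} \<and> size M = j} \<times> {S. S \<subseteq> {1..m} \<and> card S = b}"

text \<open>A semistandard tableau of hook shape \<open>(j, 1\<^sup>b)\<close> is determined by the multiset of the entries of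
  its first row and the set of the entries below the corner. The corner is the least element of
  the row, so the only condition that links the two is that it lies below all elements of the set.\<close>
definition hook_pairs :: "nat \<Rightarrow> nat \<Rightarrow> nat \<Rightarrow> (nat multiset \<times> nat set) set" where
  "hook_pairs m j b =
     {(M, S) \<in> mset_set_pairs m j b. M \<noteq> {#} \<and> (\<forall>s\<in>S. Min (set_mset M) < s)}"

definition hook_sum :: "nat \<Rightarrow> (nat \<Rightarrow> 'a::comm_ring_1) \<Rightarrow> nat \<Rightarrow> nat \<Rightarrow> 'a" where
  "hook_sum m x j b = (\<Sum>(M, S)\<in>hook_pairs m j b. (\<Prod>i\<in>#M. x i) * (\<Prod>i\<in>S. x i))"

lemma finite_multisets: "finite {M. set_mset M \<subseteq> {1..m::nat} \<and> size M = j}"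
proof (rule finite_subset)
  show "{M. set_mset M \<subseteq> {1..m} \<and> size M = j} \<subseteq> mset ` {xs. set xs \<subseteq> {1..m} \<and> length xs = j}"
  proof safe
    fix M :: "nat multiset" assume M: "set_mset M \<subseteq> {1..m}" "j = size M"
    obtain xs where "mset xs = M" using ex_mset by blast
    with M show "M \<in> mset ` {xs. set xs \<subseteq> {1..m} \<and> length xs = size M}"
      by (auto intro!: image_eqI[of _ _ xs])
  qed
qed (simp add: finite_lists_length_eq)

lemma finite_mset_set_pairs: "finite (mset_set_pairs m j b)"
  unfolding mset_set_pairs_def by (intro finite_cartesian_product finite_multisets) simp

lemma hook_pairs_subset: "hook_pairs m j b \<subseteq> mset_set_pairs m j b"
  by (auto simp: hook_pairs_def)

lemma hsym_times_esym:
  "hsym m x j * esym m x (int b) = (\<Sum>(M, S)\<in>mset_set_pairs m j b. (\<Prod>i\<in>#M. x i) * (\<Prod>i\<in>S. x i))"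
  by (simp add: hsym_def esym_nat sum_product sum.cartesian_product mset_set_pairs_def)

lemma hook_sum_0 [simp]: "hook_sum m x 0 b = 0"
proof -
  have "hook_pairs m 0 b = {}" by (auto simp: hook_pairs_def mset_set_pairs_def)
  then show ?thesis by (simp add: hook_sum_def)
qed

lemma hsym_0 [simp]: "hsym m x 0 = 1"
proof -
  have "{M. set_mset M \<subseteq> {1..m} \<and> size M = 0} = {{#}}" by auto
  then show ?thesis by (simp add: hsym_def)
qed

lemma hook_sum_row:
  assumes "0 < j"
  shows "hook_sum m x j 0 = hsym m x j"
proof -
  have "hook_pairs m j 0 = mset_set_pairs m j 0"
    using assms by (auto simp: hook_pairs_def mset_set_pairs_def dest: finite_subset)
  then show ?thesis
    using hsym_times_esym[of m x j 0] by (simp add: hook_sum_def)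
qed

text \<open>The \<open>b\<close> entries below the corner exceed it, so they avoid an element of \<open>{1..m}\<close>.\<close>
lemma hook_sum_tall:
  assumes "m \<le> b"
  shows "hook_sum m x j b = 0"
proof -
  have False if "(M, S) \<in> hook_pairs m j b" for M S
  proof -
    have S: "S \<subseteq> {1..m}" "card S = b" and M: "M \<noteq> {#}" "set_mset M \<subseteq> {1..m}"
      and less: "\<forall>s\<in>S. Min (set_mset M) < s"
      using that by (auto simp: hook_pairs_def mset_set_pairs_def)
    have "Min (set_mset M) \<in> set_mset M"
      using M by (intro Min_in) auto
    then have "Min (set_mset M) \<in> {1..m} - S"
      using M less by blast
    then have "S \<subset> {1..m}" using S by blast
    then have "card S < m" using psubset_card_mono[of "{1..m}" S] by simp
    with S assms show False by simp
  qed
  then have "hook_pairs m j b = {}" by force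
  then show ?thesis by (simp add: hook_sum_def)
qed

text \<open>The product sums over all pairs \<open>(M, S)\<close>. Those in which \<open>M\<close> is nonempty and its least
  element lies below \<open>S\<close> form the first hook. In the others the least element of \<open>S\<close> is at most
  every element of \<open>M\<close>, and moving it to \<open>M\<close> gives the second hook; the inverse moves the least
  element of the row back. As \<open>hook_pairs m 0 b\<close> is empty, the case \<open>j = 0\<close> is covered.\<close>
lemma hsym_times_esym_hooks:
  "hsym m x j * esym m x (int (Suc b)) = hook_sum m x j (Suc b) + hook_sum m x (Suc j) b"
proof -
  let ?f = "\<lambda>(M, S). (\<Prod>i\<in>#M. x i) * (\<Prod>i\<in>S. x i)"
  let ?Q = "mset_set_pairs m j (Suc b) - hook_pairs m j (Suc b)"
  have "(\<Sum>p\<in>?Q. ?f p) = (\<Sum>p\<in>hook_pairs m (Suc j) b. ?f p)"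
  proof (rule sum.reindex_bij_witness
      [where j = "\<lambda>(M, S). (add_mset (Min S) M, S - {Min S})"
         and i = "\<lambda>(M, S). (M - {#Min (set_mset M)#}, insert (Min (set_mset M)) S)"])
    fix p assume p: "p \<in> ?Q"
    obtain M S where pMS: "p = (M, S)" by fastforce
    have M: "set_mset M \<subseteq> {1..m}" "size M = j" and S: "S \<subseteq> {1..m}" "card S = Suc b"
      and le: "M = {#} \<or> (\<exists>s\<in>S. s \<le> Min (set_mset M))"
      using p by (auto simp: pMS hook_pairs_def mset_set_pairs_def not_less)
    have fin: "finite S" and ne: "S \<noteq> {}" using S by (auto intro: finite_subset)
    have in_S: "Min S \<in> S" using fin ne by simp
    have "Min S \<le> i" if "i \<in># M" for i
    proof -
      from le that obtain s where "s \<in> S" "s \<le> Min (set_mset M)" by auto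
      with fin that show ?thesis
        by (meson Min_le finite_set_mset order_trans)
    qed
    then have Min_eq: "Min (insert (Min S) (set_mset M)) = Min S"
      by (intro Min_eqI) auto
    have gt: "\<forall>s\<in>S - {Min S}. Min S < s"
      using fin by (auto simp: order_less_le)
    have "card (S - {Min S}) = b" using S in_S fin by simp
    with M S in_S gt
    show "(case p of (M, S) \<Rightarrow> (add_mset (Min S) M, S - {Min S})) \<in> hook_pairs m (Suc j) b"
      by (auto simp: pMS hook_pairs_def mset_set_pairs_def Min_eq)
    show "(case case p of (M, S) \<Rightarrow> (add_mset (Min S) M, S - {Min S})
        of (M, S) \<Rightarrow> (M - {#Min (set_mset M)#}, insert (Min (set_mset M)) S)) = p"
      using in_S by (auto simp: pMS Min_eq)
    show "?f (case p of (M, S) \<Rightarrow> (add_mset (Min S) M, S - {Min S})) = ?f p"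
      using fin in_S by (simp add: pMS prod.remove[of S "Min S"] mult_ac)
  next
    fix p assume p: "p \<in> hook_pairs m (Suc j) b"
    obtain M S where pMS: "p = (M, S)" by fastforce
    have M: "set_mset M \<subseteq> {1..m}" "size M = Suc j" and S: "S \<subseteq> {1..m}" "card S = b"
      and gt: "\<forall>s\<in>S. Min (set_mset M) < s"
      using p by (auto simp: pMS hook_pairs_def mset_set_pairs_def)
    have fin: "finite S" using S by (auto intro: finite_subset)
    define u where "u = Min (set_mset M)"
    have u: "u \<in># M" using M unfolding u_def by (intro Min_in) auto
    have nin: "u \<notin> S" using gt by (auto simp: u_def)
    have Min_eq: "Min (insert u S) = u"
      using fin gt by (intro Min_eqI) (auto simp: u_def less_imp_le)
    have "M - {#u#} = {#} \<or> u \<le> Min (set_mset (M - {#u#}))"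
      using M unfolding u_def
      by (metis Min_antimono finite_set_mset in_diffD set_mset_eq_empty_iff subsetI)
    then show "(case p of (M, S) \<Rightarrow> (M - {#Min (set_mset M)#}, insert (Min (set_mset M)) S)) \<in> ?Q"
      using M S u nin fin
      by (auto simp: pMS hook_pairs_def mset_set_pairs_def size_Diff_singleton not_less dest: in_diffD
          simp flip: u_def)
    show "(case case p of (M, S) \<Rightarrow> (M - {#Min (set_mset M)#}, insert (Min (set_mset M)) S)
        of (M, S) \<Rightarrow> (add_mset (Min S) M, S - {Min S})) = p"
      using u nin by (auto simp: pMS Min_eq simp flip: u_def)
  qed
  then have Q: "(\<Sum>p\<in>?Q. ?f p) = hook_sum m x (Suc j) b"
    by (simp add: hook_sum_def)
  have "hsym m x j * esym m x (int (Suc b)) = (\<Sum>p\<in>mset_set_pairs m j (Suc b). ?f p)"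
    by (rule hsym_times_esym)
  also have "\<dots> = (\<Sum>p\<in>?Q. ?f p) + (\<Sum>p\<in>hook_pairs m j (Suc b). ?f p)"
    by (rule sum.subset_diff[OF hook_pairs_subset finite_mset_set_pairs])
  finally show ?thesis by (simp add: Q) (simp add: hook_sum_def)
qed

text \<open>By the Pieri rule the product \<open>h\<^sub>i e\<^bsub>l-i\<^esub>\<close> with \<open>i < l\<close> is the sum of two consecutive hooks of
  size \<open>l\<close>, so the alternating sum telescopes and cancels against the last term \<open>h\<^sub>l\<close>.\<close>
lemma esym_hsym_convolution:
  "(\<Sum>i=0..l. esym m x (int (l - i)) * ((-1) ^ i * hsym m x i)) = (if l = 0 then 1 else 0)"
proof (cases l)
  case 0
  then show ?thesis by simp
next
  case (Suc r)
  let ?f = "\<lambda>i. (-1) ^ i * hook_sum m x i (Suc r - i)"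
  have "(\<Sum>i=0..l. esym m x (int (l - i)) * ((-1) ^ i * hsym m x i))
      = (\<Sum>i<Suc r. esym m x (int (Suc r - i)) * ((-1) ^ i * hsym m x i))
        + (-1) ^ Suc r * hsym m x (Suc r)"
    by (simp add: Suc atLeast0AtMost lessThan_Suc_atMost[symmetric])
  also have "(\<Sum>i<Suc r. esym m x (int (Suc r - i)) * ((-1) ^ i * hsym m x i))
      = (\<Sum>i<Suc r. ?f i - ?f (Suc i))"
  proof (rule sum.cong)
    fix i assume "i \<in> {..<Suc r}"
    then have "Suc r - i = Suc (r - i)" by auto
    then show "esym m x (int (Suc r - i)) * ((-1) ^ i * hsym m x i) = ?f i - ?f (Suc i)"
      using arg_cong[OF hsym_times_esym_hooks[of m x i "r - i"], of "\<lambda>y. (-1) ^ i * y"]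
      by (simp add: algebra_simps)
  qed simp
  also have "\<dots> = - ((-1) ^ Suc r * hsym m x (Suc r))"
    by (subst sum_lessThan_telescope') (simp add: hook_sum_row)
  finally show ?thesis by (simp add: Suc)
qed

section \<open>Hook Schur polynomials and Grothendieck polynomials\<close>

lemma young_diagram_hook:
  "young_diagram (j # replicate b 1) = {0} \<times> {..<j} \<union> {1..b} \<times> {0}"
  by (auto simp: young_diagram_def nth_Cons' split: if_splits)

lemma ssyt_hook:
  assumes "0 < j"
  shows "t \<in> ssyt m (j # replicate b 1) \<longleftrightarrow>
     t \<in> ({0} \<times> {..<j} \<union> {1..b} \<times> {0}) \<rightarrow>\<^sub>E {1..m} \<and>
     sorted (map (\<lambda>c. t (0, c)) [0..<j]) \<and>
     sorted_wrt (<) (map (\<lambda>r. t (r, 0)) [0..<Suc b])"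
proof -
  have "(\<forall>r c. (r, c) \<in> young_diagram (j # replicate b 1) \<and>
         (r, Suc c) \<in> young_diagram (j # replicate b 1) \<longrightarrow> t (r, c) \<le> t (r, Suc c)) \<longleftrightarrow>
      sorted (map (\<lambda>c. t (0, c)) [0..<j])"
    by (auto simp: young_diagram_hook sorted_iff_nth_Suc simp del: One_nat_def)
  moreover have "(\<forall>r c. (r, c) \<in> young_diagram (j # replicate b 1) \<and>
         (Suc r, c) \<in> young_diagram (j # replicate b 1) \<longrightarrow> t (r, c) < t (Suc r, c)) \<longleftrightarrow>
      sorted_wrt (<) (map (\<lambda>r. t (r, 0)) [0..<Suc b])"
  proof -
    have diag: "(r, c) \<in> young_diagram (j # replicate b 1) \<and>
        (Suc r, c) \<in> young_diagram (j # replicate b 1) \<longleftrightarrow> c = 0 \<and> r < b" for r c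
      unfolding young_diagram_hook using assms by auto
    show ?thesis
      unfolding diag
      by (auto simp: sorted_wrt_iff_nth_Suc_transp[OF transp_on_less] simp del: upt_Suc)
  qed
  ultimately show ?thesis
    unfolding ssyt_def by (simp add: young_diagram_hook del: upt_Suc One_nat_def)
qed

text \<open>The bijection of tableaux with pairs reads off the first row as a multiset and the rest of the
  first column as a set; sorting recovers the tableau.\<close>
lemma schur_hook:
  assumes "0 < j"
  shows "schur m x (j # replicate b 1) = hook_sum m x j b"
proof -
  note One_nat_def [simp del]
  define D :: "(nat \<times> nat) set" where "D = {0} \<times> {..<j} \<union> {1..b} \<times> {0}"
  define row where "row t = map (\<lambda>c. t (0, c)) [0..<j]" for t :: "nat \<times> nat \<Rightarrow> nat"
  define col where "col t = map (\<lambda>r. t (r, 0)) [1..<Suc b]" for t :: "nat \<times> nat \<Rightarrow> nat"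
  define f where "f t = (mset (row t), set (col t))" for t
  define g :: "nat multiset \<times> nat set \<Rightarrow> nat \<times> nat \<Rightarrow> nat" where "g = (\<lambda>(M, S). \<lambda>(r, c)\<in>D.
      if r = 0 then sorted_list_of_multiset M ! c else sorted_list_of_set S ! (r - 1))"
  have young: "young_diagram (j # replicate b 1) = D"
    by (simp only: young_diagram_hook D_def)
  have col0: "map (\<lambda>r. t (r, 0)) [0..<Suc b] = t (0, 0) # col t" for t
    by (simp add: col_def upt_conv_Cons One_nat_def del: upt_Suc)
  have ssyt_iff: "t \<in> ssyt m (j # replicate b 1) \<longleftrightarrow> t \<in> D \<rightarrow>\<^sub>E {1..m} \<and> sorted (row t) \<and>
      sorted_wrt (<) (col t) \<and> (\<forall>y\<in>set (col t). t (0, 0) < y)" for t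
    unfolding ssyt_hook[OF assms] col0 by (auto simp: D_def row_def)
  have row_hd: "Min (set (row t)) = t (0, 0)" if "sorted (row t)" for t
  proof (rule Min_eqI)
    show "t (0, 0) \<in> set (row t)" using assms by (auto simp: row_def)
    fix y assume "y \<in> set (row t)"
    then obtain c where "c < j" "y = t (0, c)" by (auto simp: row_def)
    then show "t (0, 0) \<le> y"
      using sorted_nth_mono[OF that, of 0 c] by (simp add: row_def)
  qed simp
  have "(\<Sum>t\<in>ssyt m (j # replicate b 1). \<Prod>p\<in>young_diagram (j # replicate b 1). x (t p))
      = (\<Sum>(M, S)\<in>hook_pairs m j b. (\<Prod>i\<in>#M. x i) * (\<Prod>i\<in>S. x i))"
  proof (rule sum.reindex_bij_witness[where j = f and i = g])
    fix t assume "t \<in> ssyt m (j # replicate b 1)"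
    then have t: "t \<in> D \<rightarrow>\<^sub>E {1..m}" and row: "sorted (row t)" and col: "sorted_wrt (<) (col t)"
      and corner: "\<forall>y\<in>set (col t). t (0, 0) < y"
      by (auto simp: ssyt_iff)
    have dist: "distinct (col t)" and srt: "sorted (col t)"
      using col by (auto simp: strict_sorted_iff)
    have sorts: "sort (row t) = row t" "sorted_list_of_set (set (col t)) = col t"
      using row dist srt by (simp_all add: sorted_sort_id sorted_list_of_set.idem_if_sorted_distinct)
    have "g (f t) = (\<lambda>(r, c)\<in>D. if r = 0 then row t ! c else col t ! (r - 1))"
      unfolding g_def f_def prod.case sorted_list_of_multiset_mset sorts ..
    also have "\<dots> = (\<lambda>p\<in>D. t p)"
      by (rule restrict_ext) (auto simp: D_def row_def col_def simp del: upt_Suc)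
    also have "\<dots> = t"
      using t by (auto simp: PiE_def extensional_restrict)
    finally show "g (f t) = t" .
    have "set (row t) \<subseteq> {1..m}" "set (col t) \<subseteq> {1..m}"
      using PiE_mem[OF t] by (fastforce simp: row_def col_def D_def simp del: upt_Suc)+
    then show "f t \<in> hook_pairs m j b"
      using assms corner dist row_hd[OF row]
      by (auto simp: f_def hook_pairs_def mset_set_pairs_def distinct_card)
         (auto simp: row_def col_def)
    have "(\<Prod>p\<in>D. x (t p)) = (\<Prod>p\<in>{0} \<times> {..<j}. x (t p)) * (\<Prod>p\<in>{1..b} \<times> {0}. x (t p))"
      unfolding D_def by (rule prod.union_disjoint) auto
    also have "(\<Prod>p\<in>{0} \<times> {..<j}. x (t p)) = (\<Prod>i\<in>#mset (row t). x i)"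
    proof -
      have "(\<Prod>p\<in>{0} \<times> {..<j}. x (t p)) = (\<Prod>c\<in>set [0..<j]. x (t (0, c)))"
        using prod.cartesian_product[of "\<lambda>r c. x (t (r, c))" "{..<j}" "{0}"]
        by (simp add: case_prod_beta atLeast0LessThan)
      also have "\<dots> = prod_list (map x (row t))"
        by (subst prod.distinct_set_conv_list) (simp_all add: row_def o_def)
      finally show ?thesis by (simp flip: mset_map add: prod_mset_prod_list)
    qed
    also have "(\<Prod>p\<in>{1..b} \<times> {0}. x (t p)) = (\<Prod>r\<in>{1..b}. x (t (r, 0)))"
      using prod.cartesian_product[of "\<lambda>r c. x (t (r, c))" "{0}" "{1..b}"]
      by (simp add: case_prod_beta)
    also have "\<dots> = (\<Prod>i\<in>set (col t). x i)"
    proof -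
      have "set (col t) = (\<lambda>r. t (r, 0)) ` {1..b}"
        by (auto simp: col_def simp del: upt_Suc)
      moreover have "inj_on (\<lambda>r. t (r, 0)) {1..b}"
        using dist unfolding col_def distinct_map
        by (simp add: atLeastLessThanSuc_atLeastAtMost del: upt_Suc)
      ultimately show ?thesis by (simp add: prod.reindex)
    qed
    finally show "(case f t of (M, S) \<Rightarrow> (\<Prod>i\<in>#M. x i) * (\<Prod>i\<in>S. x i)) =
        (\<Prod>p\<in>young_diagram (j # replicate b 1). x (t p))"
      by (simp only: f_def young prod.case)
  next
    fix p assume p: "p \<in> hook_pairs m j b"
    obtain M S where pMS: "p = (M, S)" by fastforce
    have M: "set_mset M \<subseteq> {1..m}" "size M = j" "M \<noteq> {#}" and S: "S \<subseteq> {1..m}" "card S = b"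
      and gt: "\<forall>s\<in>S. Min (set_mset M) < s"
      using p by (auto simp: pMS hook_pairs_def mset_set_pairs_def)
    have fin: "finite S" using S by (auto intro: finite_subset)
    define xs where "xs = sorted_list_of_multiset M"
    define ys where "ys = sorted_list_of_set S"
    have xs: "length xs = j" "set xs = set_mset M" "sorted xs" "mset xs = M"
      unfolding xs_def using M by (simp_all flip: size_mset)
    have ys: "length ys = b" "set ys = S" "sorted_wrt (<) ys"
      unfolding ys_def using S fin by simp_all
    have gp: "g p = (\<lambda>(r, c)\<in>D. if r = 0 then xs ! c else ys ! (r - 1))"
      unfolding g_def pMS xs_def ys_def prod.case ..
    have row: "row (g p) = xs"
      by (rule nth_equalityI) (auto simp: row_def gp D_def xs)
    have col: "col (g p) = ys"
      by (rule nth_equalityI) (auto simp: col_def gp D_def ys simp del: upt_Suc)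
    show "f (g p) = p"
      unfolding f_def row col by (simp add: pMS xs ys)
    have "g p (0, 0) = Min (set_mset M)"
      using row_hd[of "g p"] by (simp add: row xs)
    moreover have "g p \<in> D \<rightarrow>\<^sub>E {1..m}"
    proof -
      have "xs ! c \<in> {1..m}" if "c < j" for c
        using that xs(1,2) M(1) nth_mem[of c xs] by blast
      moreover have "ys ! (r - 1) \<in> {1..m}" if "r \<in> {1..b}" for r
      proof -
        have "r - 1 < length ys" using that ys(1) by auto
        then have "ys ! (r - 1) \<in> S" using ys(2) nth_mem by blast
        then show ?thesis using S(1) by blast
      qed
      ultimately show ?thesis unfolding gp by (auto simp: D_def)
    qed
    ultimately show "g p \<in> ssyt m (j # replicate b 1)"
      using gt by (simp add: ssyt_iff row col xs ys)
  qed
  then show ?thesis by (simp add: schur_def hook_sum_def)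
qed

text \<open>The term \<open>b = m\<close> vanishes. It is included so that the range of summation is that of the
  \<open>e\<^sub>b\<close> in \<open>\<Prod>\<^sub>i (1 - x\<^sub>i)\<close>.\<close>
lemma grothendieck_hook_sum:
  assumes "0 < j"
  shows "grothendieck m x j = (\<Sum>b=0..m. (-1) ^ b * hook_sum m x j b)"
proof -
  have "(\<Sum>a=2..m. (-1) ^ a * schur m x (j # replicate (a - 1) 1))
      = - (\<Sum>b=1..<m. (-1) ^ b * hook_sum m x j b)"
  proof -
    have "(\<Sum>a=2..m. (-1) ^ a * schur m x (j # replicate (a - 1) 1))
        = (\<Sum>b=1..<m. (-1) ^ Suc b * hook_sum m x j b)"
      by (rule sum.reindex_bij_witness[of _ Suc "\<lambda>a. a - 1"])
         (auto simp: schur_hook[OF assms, unfolded One_nat_def])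
    then show ?thesis by (simp add: sum_negf)
  qed
  moreover have "(\<Sum>b=0..m. (-1) ^ b * hook_sum m x j b)
      = hsym m x j + (\<Sum>b=1..<m. (-1) ^ b * hook_sum m x j b)"
  proof (cases "m = 0")
    case True
    then show ?thesis using hook_sum_tall[of m 0 x j] hook_sum_row[OF assms, of m x] by simp
  next
    case False
    then have "{0..m} = insert 0 (insert m {1..<m})" by auto
    with False show ?thesis by (simp add: hook_sum_row[OF assms] hook_sum_tall)
  qed
  ultimately show ?thesis using assms by (simp add: grothendieck_def)
qed

text \<open>Expand the product as \<open>\<Sum>\<^sub>b (-1)\<^sup>b e\<^sub>b\<close> and apply the Pieri rule to every \<open>h\<^sub>j e\<^sub>b\<close>: the hooks with
  first row \<open>j\<close> add up to \<open>G\<^sub>j\<close> and those with first row \<open>j + 1\<close> to \<open>- G\<^bsub>j+1\<^esub>\<close>. For \<open>j = 0\<close> only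
  the term \<open>h\<^sub>0 e\<^sub>0 = 1\<close> remains of the first kind, and it is \<open>G\<^sub>0\<close>.\<close>
lemma grothendieck_Suc:
  "grothendieck m x (Suc j) = grothendieck m x j - (\<Prod>i=1..m. 1 - x i) * hsym m x j"
proof -
  let ?H = "hook_sum m x"
  have *: "(\<Prod>i=1..m. 1 - x i) * hsym m x j
      = hsym m x j + (\<Sum>b<m. (-1) ^ Suc b * ?H j (Suc b)) + (\<Sum>b<m. (-1) ^ Suc b * ?H (Suc j) b)"
  proof -
    have "(\<Prod>i=1..m. 1 - x i) * hsym m x j
        = (\<Sum>b=0..m. (-1) ^ b * (hsym m x j * esym m x (int b)))"
      by (simp add: prod_one_minus_eq_sum_esym sum_distrib_left mult_ac del: One_nat_def)
    also have "\<dots> = hsym m x j + (\<Sum>b<m. (-1) ^ Suc b * (hsym m x j * esym m x (int (Suc b))))"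
      unfolding atLeast0AtMost sum.atMost_shift by simp
    also have "\<dots> = hsym m x j + (\<Sum>b<m. (-1) ^ Suc b * ?H j (Suc b) + (-1) ^ Suc b * ?H (Suc j) b)"
      unfolding hsym_times_esym_hooks by (simp add: distrib_left)
    finally show ?thesis by (simp only: sum.distrib add.assoc)
  qed
  have "(\<Sum>b<m. (-1) ^ Suc b * ?H (Suc j) b) = - grothendieck m x (Suc j)"
    by (simp add: grothendieck_hook_sum atLeast0AtMost sum.lessThan_Suc hook_sum_tall sum_negf
        flip: lessThan_Suc_atMost)
  moreover have "hsym m x j + (\<Sum>b<m. (-1) ^ Suc b * ?H j (Suc b)) = grothendieck m x j"
  proof (cases "j = 0")
    case True
    then show ?thesis by (simp add: grothendieck_def)
  next
    case False
    then show ?thesis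
      by (simp add: grothendieck_hook_sum atLeast0AtMost sum.atMost_shift hook_sum_row)
  qed
  ultimately show ?thesis using * by (simp add: algebra_simps)
qed

lemma c_ge_plus_c_ge_Suc: "c_ge m x j + c_ge m x (Suc j) = esym m x (int j)"
proof (cases "j \<le> m")
  case True
  have "(\<Sum>i=Suc j..m. (-1) ^ (i - j) * esym m x (int i)) = - c_ge m x (Suc j)"
    unfolding c_ge_def sum_negf[symmetric]
    by (rule sum.cong) (auto simp: Suc_diff_Suc[symmetric])
  with True show ?thesis
    by (simp add: c_ge_def[of m x j] sum.atLeast_Suc_atMost)
qed (simp add: c_ge_def esym_above)

lemma prod_one_minus_c_ge: "(\<Prod>i=1..m. 1 - x i) = 1 - c_ge m x 1"
  using c_ge_plus_c_ge_Suc[of m x 0]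
  unfolding prod_one_minus_eq_sum_esym by (simp add: c_ge_def[of m x 0] algebra_simps)

text \<open>By the recursion for \<open>G\<close> and the relation of \<open>e\<close> and \<open>h\<close>, the sums \<open>D\<^sub>l\<close> on the left satisfy
  \<open>D\<^bsub>l+1\<^esub> = e\<^bsub>l+1\<^esub> - D\<^sub>l\<close>, with a correction by \<open>\<Prod>\<^sub>i (1 - x\<^sub>i)\<close> only at \<open>l = 0\<close>. The tails
  \<open>c_ge\<close> satisfy the same recursion by \<open>c_ge_plus_c_ge_Suc\<close>.\<close>
lemma esym_grothendieck_convolution:
  "(\<Sum>b=0..l. esym m x (int (l - b)) * ((-1) ^ b * grothendieck m x b))
     = (if l = 0 then 1 else c_ge m x (Suc l))"
proof (induction l)
  case 0
  then show ?case by (simp add: grothendieck_def)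
next
  case (Suc l)
  let ?c = "\<Prod>i=1..m. 1 - x i"
  have "(\<Sum>b=0..Suc l. esym m x (int (Suc l - b)) * ((-1) ^ b * grothendieck m x b))
      = esym m x (int (Suc l))
        + (\<Sum>b=0..l. esym m x (int (l - b)) * ((-1) ^ Suc b * grothendieck m x (Suc b)))"
    unfolding atLeast0AtMost sum.atMost_Suc_shift by (simp add: grothendieck_def)
  also have "(\<Sum>b=0..l. esym m x (int (l - b)) * ((-1) ^ Suc b * grothendieck m x (Suc b)))
      = ?c * (\<Sum>b=0..l. esym m x (int (l - b)) * ((-1) ^ b * hsym m x b))
        - (\<Sum>b=0..l. esym m x (int (l - b)) * ((-1) ^ b * grothendieck m x b))"
    unfolding grothendieck_Suc sum_distrib_left sum_subtractf[symmetric]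
    by (rule sum.cong) (simp_all add: algebra_simps)
  also have "\<dots> = (if l = 0 then ?c - 1 else - c_ge m x (Suc l))"
    unfolding Suc.IH esym_hsym_convolution by simp
  finally show ?case
    using c_ge_plus_c_ge_Suc[of m x "Suc l"] by (auto simp: prod_one_minus_c_ge[unfolded One_nat_def] algebra_simps)
qed

section \<open>Evaluation of polynomials\<close>

locale ring_morphism =
  fixes f :: "'a::comm_ring_1 \<Rightarrow> 'b::comm_ring_1"
  assumes one: "f 1 = 1"
    and add: "f (a + b) = f a + f b"
    and mult: "f (a * b) = f a * f b"
begin

lemma zero: "f 0 = 0"
  using add[of 0 0] by simp

lemma uminus: "f (- a) = - f a"
  using add[of a "- a"] by (simp add: zero eq_neg_iff_add_eq_0 add.commute)

lemma sum: "f (\<Sum>i\<in>A. g i) = (\<Sum>i\<in>A. f (g i))"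
  by (induction A rule: infinite_finite_induct) (simp_all add: zero add)

lemma prod: "f (\<Prod>i\<in>A. g i) = (\<Prod>i\<in>A. f (g i))"
  by (induction A rule: infinite_finite_induct) (simp_all add: one mult)

lemma esym: "f (esym m x d) = esym m (\<lambda>i. f (x i)) d"
  by (simp add: esym_def sum prod)

end

lemma ring_morphism_comp:
  assumes "ring_morphism f" "ring_morphism g"
  shows "ring_morphism (\<lambda>a. g (f a))"
  using assms by (simp add: ring_morphism_def)

definition monomial_value :: "('v \<Rightarrow> 'b::comm_ring_1) \<Rightarrow> ('v \<Rightarrow>\<^sub>0 nat) \<Rightarrow> 'b" where
  "monomial_value x m = (\<Prod>v\<in>Poly_Mapping.keys m. x v ^ Poly_Mapping.lookup m v)"

definition polynomial_value ::
  "('a::comm_ring_1 \<Rightarrow> 'b::comm_ring_1) \<Rightarrow> ('v \<Rightarrow> 'b) \<Rightarrow> (('v \<Rightarrow>\<^sub>0 nat) \<Rightarrow>\<^sub>0 'a) \<Rightarrow> 'b" where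
  "polynomial_value \<kappa> x p =
     (\<Sum>m\<in>Poly_Mapping.keys p. \<kappa> (Poly_Mapping.lookup p m) * monomial_value x m)"

lemma monomial_value_superset:
  assumes "finite V" "Poly_Mapping.keys m \<subseteq> V"
  shows "monomial_value x m = (\<Prod>v\<in>V. x v ^ Poly_Mapping.lookup m v)"
  unfolding monomial_value_def
  by (rule prod.mono_neutral_left) (use assms in \<open>auto simp: in_keys_iff\<close>)

lemma monomial_value_add: "monomial_value x (m + m') = monomial_value x m * monomial_value x m'"
proof -
  let ?V = "Poly_Mapping.keys m \<union> Poly_Mapping.keys m'"
  show ?thesis
    using monomial_value_superset[of ?V m x] monomial_value_superset[of ?V m' x]
      monomial_value_superset[of ?V "m + m'" x] Poly_Mapping.keys_add[of m m']
    by (simp add: lookup_add power_add prod.distrib)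
qed

lemma poly_mapping_eq_sum_single:
  fixes p :: "'m \<Rightarrow>\<^sub>0 'a::comm_monoid_add"
  shows "p = (\<Sum>m\<in>Poly_Mapping.keys p. Poly_Mapping.single m (Poly_Mapping.lookup p m))"
proof (rule poly_mapping_eqI)
  fix m
  show "Poly_Mapping.lookup p m = Poly_Mapping.lookup
      (\<Sum>m\<in>Poly_Mapping.keys p. Poly_Mapping.single m (Poly_Mapping.lookup p m)) m"
    by (simp add: lookup_sum lookup_single when_def sum.delta in_keys_iff)
qed

context ring_morphism
begin

lemma polynomial_value_superset:
  assumes "finite A" "Poly_Mapping.keys p \<subseteq> A"
  shows "polynomial_value f x p = (\<Sum>m\<in>A. f (Poly_Mapping.lookup p m) * monomial_value x m)"
  unfolding polynomial_value_def
  by (rule sum.mono_neutral_left) (use assms in \<open>auto simp: in_keys_iff zero\<close>)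

lemma polynomial_value_add:
  "polynomial_value f x (p + p') = polynomial_value f x p + polynomial_value f x p'"
proof -
  let ?A = "Poly_Mapping.keys p \<union> Poly_Mapping.keys p'"
  show ?thesis
    using polynomial_value_superset[of ?A p x] polynomial_value_superset[of ?A p' x]
      polynomial_value_superset[of ?A "p + p'" x] Poly_Mapping.keys_add[of p p']
    by (simp add: lookup_add add distrib_right sum.distrib)
qed

lemma polynomial_value_sum:
  "polynomial_value f x (\<Sum>i\<in>A. p i) = (\<Sum>i\<in>A. polynomial_value f x (p i))"
  by (induction A rule: infinite_finite_induct)
     (simp_all add: polynomial_value_add, simp_all add: polynomial_value_def)

lemma polynomial_value_single:
  "polynomial_value f x (Poly_Mapping.single m c) = f c * monomial_value x m"
  by (simp add: polynomial_value_def zero)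

lemma polynomial_value_mult:
  "polynomial_value f x (p * p') = polynomial_value f x p * polynomial_value f x p'"
proof -
  let ?K = Poly_Mapping.keys and ?l = Poly_Mapping.lookup
  have "p * p' = (\<Sum>m\<in>?K p. Poly_Mapping.single m (?l p m)) *
      (\<Sum>m'\<in>?K p'. Poly_Mapping.single m' (?l p' m'))"
    using poly_mapping_eq_sum_single[of p] poly_mapping_eq_sum_single[of p'] by simp
  also have "\<dots> = (\<Sum>m\<in>?K p. \<Sum>m'\<in>?K p'. Poly_Mapping.single (m + m') (?l p m * ?l p' m'))"
    by (simp add: sum_product mult_single)
  finally show ?thesis
    by (simp add: polynomial_value_sum polynomial_value_single)
       (simp add: polynomial_value_def sum_product mult monomial_value_add mult_ac)
qed

lemma ring_morphism_polynomial_value: "ring_morphism (polynomial_value f x)"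
proof
  show "polynomial_value f x 1 = 1"
    using polynomial_value_single[of x 0 1] by (simp add: one monomial_value_def)
qed (rule polynomial_value_add polynomial_value_mult)+

lemma polynomial_value_const: "polynomial_value f x (Poly_Mapping.single 0 c) = f c"
  by (simp add: polynomial_value_single monomial_value_def)

lemma polynomial_value_var:
  "polynomial_value f x (Poly_Mapping.single (Poly_Mapping.single v 1) 1) = x v"
  by (simp add: polynomial_value_single monomial_value_def one)

end

section \<open>Prescribed elementary symmetric functions\<close>

text \<open>The roots of \<open>\<Sum>\<^sub>j (-1)\<^sup>j c\<^sub>j X\<^bsup>m-j\<^esup>\<close>, with multiplicity, have the prescribed elementary symmetric
  functions by Vieta's formula.\<close>
lemma exists_prescribed_esym:
  fixes c :: "nat \<Rightarrow> 'a::alg_closed_field"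
  assumes "c 0 = 1"
  shows "\<exists>r. \<forall>j\<le>m. esym m r (int j) = c j"
proof -
  define p where "p = (\<Sum>j=0..m. Polynomial.monom ((-1) ^ j * c j) (m - j))"
  have coeff_p: "Polynomial.coeff p (m - j) = (-1) ^ j * c j" if "j \<le> m" for j
  proof -
    have "Polynomial.coeff p (m - j) = (\<Sum>i=0..m. if i = j then (-1) ^ i * c i else 0)"
      unfolding p_def Polynomial.coeff_sum Polynomial.coeff_monom
      by (rule sum.cong) (use that in auto)
    then show ?thesis using that by simp
  qed
  have "Polynomial.degree p \<le> m"
    unfolding p_def by (intro degree_sum_le) (auto intro: order_trans[OF degree_monom_le])
  moreover have "Polynomial.coeff p m = 1"
    using coeff_p[of 0] assms by simp
  ultimately have deg: "Polynomial.degree p = m" and lead: "Polynomial.lead_coeff p = 1"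
    using le_degree[of p m] by (auto simp: le_antisym)
  then have "p \<noteq> 0" by auto
  then obtain A where A: "size A = m" "p = (\<Prod>x\<in>#A. [:- x, 1:])"
    using alg_closed_imp_factorization[of p] deg lead by auto
  obtain rs where rs: "mset rs = A" using ex_mset by blast
  define r where "r i = rs ! (i - 1)" for i
  interpret C: ring_morphism "\<lambda>a::'a. [:a:]"
    by standard (simp_all add: one_pCons)
  have "p = (\<Prod>x\<leftarrow>rs. [:- x, 1:])"
    by (simp add: A rs[symmetric] flip: prod_mset_prod_list mset_map)
  also have "\<dots> = (\<Prod>i<m. [:- (rs ! i), 1:])"
  proof -
    have "length rs = m" using A(1) by (simp flip: rs)
    then show ?thesis
      by (simp add: prod.list_conv_set_nth atLeast0LessThan)
  qed
  also have "\<dots> = (\<Prod>i=1..m. [:- r i, 1:])"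
    by (rule prod.reindex_bij_witness[of _ "\<lambda>i. i - 1" Suc]) (auto simp: r_def)
  also have "\<dots> = (\<Prod>i=1..m. [:0, 1:] + (- 1) * [:r i:])"
    by simp
  also have "\<dots> = (\<Sum>j=0..m. esym m (\<lambda>i. [:r i:]) (int j) * (- 1) ^ j * [:0, 1:] ^ (m - j))"
    by (rule prod_add_esym)
  also have "\<dots> = (\<Sum>j=0..m. Polynomial.monom ((-1) ^ j * esym m r (int j)) (m - j))"
  proof (rule sum.cong)
    fix j
    have "(- 1) ^ j = [:(- 1) ^ j :: 'a:]"
      by (induction j) (simp_all add: one_pCons)
    then show "esym m (\<lambda>i. [:r i:]) (int j) * (- 1) ^ j * [:0, 1:] ^ (m - j)
        = Polynomial.monom ((-1) ^ j * esym m r (int j)) (m - j)"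
      by (simp add: C.esym[symmetric] monom_altdef mult_ac)
  qed simp
  finally have p_esym: "p = \<dots>" .
  have "esym m r (int j) = c j" if "j \<le> m" for j
  proof -
    have "Polynomial.coeff p (m - j) = (\<Sum>i=0..m. if i = j then (-1) ^ i * esym m r (int i) else 0)"
      unfolding p_esym Polynomial.coeff_sum Polynomial.coeff_monom
      by (rule sum.cong) (use that in auto)
    with coeff_p[OF that] that show ?thesis by simp
  qed
  then show ?thesis by blast
qed

section \<open>An algebraically closed field that contains the polynomial ring\<close>

text \<open>Any linear order on the variables makes the monomials an ordered monoid; comparing leading
  terms then shows that the polynomial ring is an integral domain, so it has a fraction field.\<close>
instantiation var :: linorder
begin

fun var_code :: "var \<Rightarrow> nat" where
  "var_code (Z i) = 2 * i"
| "var_code (W j) = 2 * j + 1"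

definition "u \<le> v \<longleftrightarrow> var_code u \<le> var_code v"
definition "u < v \<longleftrightarrow> var_code u < var_code v"

lemma var_code_inject: "var_code u = var_code v \<Longrightarrow> u = v"
  by (cases u; cases v) (auto, presburger+)

instance
  by standard (auto simp: less_eq_var_def less_var_def intro: var_code_inject)

end

definition embed :: "pol \<Rightarrow> pol fract alg_closure" where
  "embed p = to_ac (Fract p 1)"

lemma ring_morphism_embed: "ring_morphism embed"
  by standard (simp_all add: embed_def flip: One_fract_def to_ac_add to_ac_mult)

lemma embed_eq_iff [simp]: "embed p = embed p' \<longleftrightarrow> p = p'"
  by (simp add: embed_def eq_fract)

section \<open>Subrings generated over the coefficient ring\<close>

lemma carrier_adjoin:
  "carrier (adjoin n S) = generate_ring cring_class_ops (const ` KTq n \<union> S)"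
  by (simp add: adjoin_def)

lemma adjoin_ops [simp]:
  "x \<otimes>\<^bsub>adjoin n S\<^esub> y = x * y" "x \<oplus>\<^bsub>adjoin n S\<^esub> y = x + y"
  "\<one>\<^bsub>adjoin n S\<^esub> = 1" "\<zero>\<^bsub>adjoin n S\<^esub> = 0"
  by (simp_all add: adjoin_def cring_class_ops_def)

lemma cring_adjoin: "cring (adjoin n S)"
proof -
  have "ring (cring_class_ops :: pol ring)"
    by (rule cring.axioms(1)[OF cring_class])
  from ring.generate_ring_is_ring[OF this] interpret R: ring "adjoin n S"
    unfolding adjoin_def by (simp add: cring_class_ops_def)
  show ?thesis
    by (rule cring.intro[OF R.ring_axioms], unfold_locales) (simp add: mult.commute)
qed

lemma adjoin_uminus [simp]:
  assumes "x \<in> carrier (adjoin n S)"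
  shows "\<ominus>\<^bsub>adjoin n S\<^esub> x = - x"
proof -
  interpret R: cring "adjoin n S" by (rule cring_adjoin)
  show ?thesis
    using R.l_neg[OF assms] by (simp add: eq_neg_iff_add_eq_0)
qed

lemma adjoin_const: "c \<in> KTq n \<Longrightarrow> const c \<in> carrier (adjoin n S)"
  and adjoin_gen: "s \<in> S \<Longrightarrow> s \<in> carrier (adjoin n S)"
  and adjoin_1: "1 \<in> carrier (adjoin n S)"
  and adjoin_minus: "x \<in> carrier (adjoin n S) \<Longrightarrow> - x \<in> carrier (adjoin n S)"
  and adjoin_add: "x \<in> carrier (adjoin n S) \<Longrightarrow> y \<in> carrier (adjoin n S) \<Longrightarrow> x + y \<in> carrier (adjoin n S)"
  and adjoin_mult: "x \<in> carrier (adjoin n S) \<Longrightarrow> y \<in> carrier (adjoin n S) \<Longrightarrow> x * y \<in> carrier (adjoin n S)"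
  unfolding carrier_adjoin
  using generate_ring.intros[where R = "cring_class_ops :: pol ring" and H = "const ` KTq n \<union> S"]
  by (simp_all only: one_class plus_class times_class uminus_class) blast+

lemma adjoin_0: "0 \<in> carrier (adjoin n S)"
  using adjoin_add[OF adjoin_1 adjoin_minus[OF adjoin_1]] by simp

lemma adjoin_diff:
  "x \<in> carrier (adjoin n S) \<Longrightarrow> y \<in> carrier (adjoin n S) \<Longrightarrow> x - y \<in> carrier (adjoin n S)"
  using adjoin_add[OF _ adjoin_minus] by fastforce

lemma adjoin_sum:
  "(\<And>i. i \<in> A \<Longrightarrow> f i \<in> carrier (adjoin n S)) \<Longrightarrow> (\<Sum>i\<in>A. f i) \<in> carrier (adjoin n S)"
  by (induction A rule: infinite_finite_induct) (simp_all add: adjoin_0 adjoin_add)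

lemma adjoin_prod:
  "(\<And>i. i \<in> A \<Longrightarrow> f i \<in> carrier (adjoin n S)) \<Longrightarrow> (\<Prod>i\<in>A. f i) \<in> carrier (adjoin n S)"
  by (induction A rule: infinite_finite_induct) (simp_all add: adjoin_1 adjoin_mult)

lemma adjoin_power: "x \<in> carrier (adjoin n S) \<Longrightarrow> x ^ d \<in> carrier (adjoin n S)"
  by (induction d) (simp_all add: adjoin_1 adjoin_mult)

lemma adjoin_of_nat: "of_nat d \<in> carrier (adjoin n S)"
  by (induction d) (simp_all add: adjoin_0 adjoin_1 adjoin_add)

lemmas adjoin_closed =
  adjoin_0 adjoin_1 adjoin_minus adjoin_add adjoin_mult adjoin_diff adjoin_sum adjoin_prod
  adjoin_power adjoin_of_nat

lemma adjoin_induct [consumes 1, case_names const gen one minus add mult]: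
  assumes "x \<in> carrier (adjoin n S)"
    and "\<And>c. c \<in> KTq n \<Longrightarrow> P (const c)" "\<And>s. s \<in> S \<Longrightarrow> P s" "P 1"
    and "\<And>x. x \<in> carrier (adjoin n S) \<Longrightarrow> P x \<Longrightarrow> P (- x)"
    and "\<And>x y. x \<in> carrier (adjoin n S) \<Longrightarrow> y \<in> carrier (adjoin n S) \<Longrightarrow> P x \<Longrightarrow> P y \<Longrightarrow> P (x + y)"
    and "\<And>x y. x \<in> carrier (adjoin n S) \<Longrightarrow> y \<in> carrier (adjoin n S) \<Longrightarrow> P x \<Longrightarrow> P y \<Longrightarrow> P (x * y)"
  shows "P x"
  using assms(1) unfolding carrier_adjoin
proof induction
  case one
  then show ?case by (simp add: one_class assms(4))
next
  case (incl h)
  then show ?case using assms(2,3) by blast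
next
  case (a_inv h)
  then show ?case using assms(5) by (simp add: uminus_class carrier_adjoin)
next
  case (eng_add h1 h2)
  then show ?case using assms(6) by (simp add: plus_class carrier_adjoin)
next
  case (eng_mult h1 h2)
  then show ?case using assms(7) by (simp add: times_class carrier_adjoin)
qed

lemma adjoin_mono:
  assumes "S \<subseteq> S'"
  shows "carrier (adjoin n S) \<subseteq> carrier (adjoin n S')"
proof
  fix x assume "x \<in> carrier (adjoin n S)"
  then show "x \<in> carrier (adjoin n S')"
    by (induction rule: adjoin_induct) (use assms in \<open>auto intro: adjoin_closed adjoin_const adjoin_gen\<close>)
qed

lemma sym_z_subset: "carrier (sym_z n k) \<subseteq> carrier (sym_zw n k)"
  unfolding sym_z_def sym_zw_def by (rule adjoin_mono) blast

lemma esym_z_mem: "esym k z d \<in> carrier (sym_z n k)"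
proof (cases "1 \<le> d \<and> d \<le> int k")
  case True
  then show ?thesis
    unfolding sym_z_def by (intro adjoin_gen) (auto intro!: exI[of _ "nat d"])
next
  case False
  then consider "d < 0" | "d = 0" | "int k < d" by linarith
  then show ?thesis by cases (simp_all add: sym_z_def esym_above adjoin_closed)
qed

lemma esym_w_mem: "esym (n - k) w d \<in> carrier (sym_zw n k)"
proof (cases "1 \<le> d \<and> d \<le> int (n - k)")
  case True
  then show ?thesis
    unfolding sym_zw_def by (intro adjoin_gen UnI2) (auto intro!: exI[of _ "nat d"])
next
  case False
  then consider "d < 0" | "d = 0" | "int (n - k) < d" by linarith
  then show ?thesis by cases (simp_all add: sym_zw_def esym_above adjoin_closed)
qed

lemma one_minus_T_KT:
  assumes "i \<in> {1..n}"
  shows "1 - T i \<in> KT n"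
proof -
  have "Poly_Mapping.keys (1 - T i) \<subseteq> {0, Poly_Mapping.single i 1}"
  proof -
    have "Poly_Mapping.keys (1 :: laurent) = {0}"
      by (simp flip: single_one)
    moreover have "Poly_Mapping.keys (T i) = {Poly_Mapping.single i 1}"
      by (simp add: T_def)
    ultimately show ?thesis
      using keys_diff[of "1 :: laurent" "T i"] by auto
  qed
  with assms show ?thesis by (fastforce simp: KT_def)
qed

lemma zeta_mem:
  assumes "i \<in> {1..n}"
  shows "\<zeta> i \<in> carrier (adjoin n S)"
  unfolding \<zeta>_def using one_minus_T_KT[OF assms]
  by (intro adjoin_const) (auto simp: KTq_def KT_def)

lemma q_mem: "q \<in> carrier (adjoin n S)"
  unfolding q_def by (rule adjoin_const) (auto simp: KTq_def KT_def fps_X_def)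

lemma q_over_one_minus_q_mem: "q_over_one_minus_q \<in> carrier (adjoin n S)"
  unfolding q_over_one_minus_q_def
  by (rule adjoin_const) (auto simp: KTq_def KT_def)

lemma esym_mem:
  assumes "\<And>i. i \<in> {1..m} \<Longrightarrow> x i \<in> carrier (adjoin n S)"
  shows "esym m x d \<in> carrier (adjoin n S)"
  unfolding esym_def by (intro adjoin_sum adjoin_prod) (use assms in blast)

lemma c_ge_mem:
  assumes "\<And>d. esym m x d \<in> carrier (adjoin n S)"
  shows "c_ge m x j \<in> carrier (adjoin n S)"
  unfolding c_ge_def by (intro adjoin_closed assms)

text \<open>The convolution identity expresses \<open>h\<^sub>j\<close> through the \<open>e\<^sub>i\<close> and the \<open>h\<^sub>i\<close> with \<open>i < j\<close>.\<close>
lemma hsym_mem: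
  assumes "\<And>d. esym m x d \<in> carrier (adjoin n S)"
  shows "hsym m x j \<in> carrier (adjoin n S)"
proof (induction j rule: less_induct)
  case (less j)
  show ?case
  proof (cases j)
    case 0
    then show ?thesis by (simp add: adjoin_1)
  next
    case (Suc l)
    have "(-1) ^ Suc l * hsym m x (Suc l)
        = - (\<Sum>i=0..l. esym m x (int (Suc l - i)) * ((-1) ^ i * hsym m x i))"
      using esym_hsym_convolution[of m x "Suc l"] by (simp add: eq_neg_iff_add_eq_0 add.commute)
    also have "\<dots> \<in> carrier (adjoin n S)"
      by (intro adjoin_closed assms less.IH) (simp add: Suc)
    finally have *: "(-1) ^ Suc l * hsym m x (Suc l) \<in> carrier (adjoin n S)" .
    have "(-1) ^ Suc l * ((-1) ^ Suc l * hsym m x (Suc l)) \<in> carrier (adjoin n S)"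
      by (rule adjoin_mult[OF _ *]) (intro adjoin_power adjoin_minus adjoin_1)
    moreover have "(-1) ^ Suc l * ((-1) ^ Suc l * hsym m x (Suc l)) = hsym m x (Suc l)"
      by (cases "even l") simp_all
    ultimately show ?thesis unfolding Suc by metis
  qed
qed

lemma grothendieck_mem:
  assumes "\<And>d. esym m x d \<in> carrier (adjoin n S)"
  shows "grothendieck m x j \<in> carrier (adjoin n S)"
proof (induction j)
  case 0
  then show ?case by (simp add: grothendieck_def adjoin_1)
next
  case (Suc j)
  have *: "(\<Prod>i=1..m. 1 - x i) \<in> carrier (adjoin n S)"
    unfolding prod_one_minus_eq_sum_esym by (intro adjoin_closed assms)
  show ?case unfolding grothendieck_Suc
    by (intro adjoin_diff adjoin_mult Suc hsym_mem assms) (rule *)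
qed

section \<open>Specialisation of the second set of variables\<close>

text \<open>Substituting roots \<open>r\<^sub>j\<close> with elementary symmetric functions \<open>c\<^sub>j\<close> for the \<open>w\<^sub>j\<close> maps the whole
  polynomial ring to the algebraic closure. On the generators of \<open>sym_zw n k\<close> the values lie in the
  embedded copy of \<open>sym_z n k\<close>, hence they do on all of it, and the embedding can be undone.\<close>
lemma exists_specialisation:
  assumes "\<And>j. c j \<in> carrier (sym_z n k)" "c 0 = 1"
  shows "\<exists>\<phi>. \<phi> \<in> ring_hom (sym_zw n k) (sym_z n k) \<and> (\<forall>f\<in>carrier (sym_z n k). \<phi> f = f) \<and>
     (\<forall>j\<le>n - k. \<phi> (esym (n - k) w (int j)) = c j)"
proof -
  interpret embed: ring_morphism embed by (rule ring_morphism_embed)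
  obtain r where r: "\<And>j. j \<le> n - k \<Longrightarrow> esym (n - k) r (int j) = embed (c j)"
    using exists_prescribed_esym[of "\<lambda>j. embed (c j)" "n - k"] assms(2) embed.one by metis
  define x where "x v = (case v of Z i \<Rightarrow> embed (z i) | W j \<Rightarrow> r j)" for v
  interpret C: ring_morphism "\<lambda>a. embed (const a)"
  proof (rule ring_morphism_comp[OF _ ring_morphism_embed])
    show "ring_morphism const"
      by standard (simp_all add: const_def single_add mult_single)
  qed
  define \<psi> where "\<psi> = polynomial_value (\<lambda>a. embed (const a)) x"
  interpret psi: ring_morphism \<psi>
    unfolding \<psi>_def by (rule C.ring_morphism_polynomial_value)
  have psi_const: "\<psi> (const a) = embed (const a)" for a
    unfolding \<psi>_def by (subst (2) const_def) (rule C.polynomial_value_const)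
  have psi_var: "\<psi> (pvar v) = x v" for v
    unfolding \<psi>_def pvar_def by (rule C.polynomial_value_var)
  have psi_z: "\<psi> (esym k z d) = embed (esym k z d)" for d
    by (simp add: psi.esym embed.esym psi_var x_def)
  have psi_w: "\<psi> (esym (n - k) w (int j)) = embed (c j)" if "j \<le> n - k" for j
    using r[OF that] by (simp add: psi.esym psi_var x_def)
  have psi_sym_z: "\<psi> f = embed f" if "f \<in> carrier (sym_z n k)" for f
    using that unfolding sym_z_def
    by (induction rule: adjoin_induct)
       (auto simp: psi_const psi_z psi.one psi.uminus psi.add psi.mult
          embed.one embed.uminus embed.add embed.mult)
  have range: "\<exists>g\<in>carrier (sym_z n k). \<psi> f = embed g" if "f \<in> carrier (sym_zw n k)" for f
    using that unfolding sym_zw_def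
  proof (induction rule: adjoin_induct)
    case (const c)
    then show ?case using psi_const by (auto simp: sym_z_def intro: adjoin_const)
  next
    case (gen s)
    then show ?case using psi_z psi_w esym_z_mem assms(1) by auto
  next
    case one
    then show ?case using psi.one embed.one by (auto simp: sym_z_def intro: adjoin_1)
  next
    case (minus f)
    then obtain f' where "f' \<in> carrier (sym_z n k)" "\<psi> f = embed f'" by blast
    then show ?case
      by (intro bexI[of _ "- f'"])
         (auto simp: psi.uminus embed.uminus sym_z_def intro: adjoin_closed)
  next
    case (add f g)
    then obtain f' g' where "f' \<in> carrier (sym_z n k)" "\<psi> f = embed f'"
      "g' \<in> carrier (sym_z n k)" "\<psi> g = embed g'" by blast
    then show ?case
      by (intro bexI[of _ "f' + g'"])
         (auto simp: psi.add embed.add sym_z_def intro: adjoin_closed)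
  next
    case (mult f g)
    then obtain f' g' where "f' \<in> carrier (sym_z n k)" "\<psi> f = embed f'"
      "g' \<in> carrier (sym_z n k)" "\<psi> g = embed g'" by blast
    then show ?case
      by (intro bexI[of _ "f' * g'"])
         (auto simp: psi.mult embed.mult sym_z_def intro: adjoin_closed)
  qed
  define \<phi> where "\<phi> f = (THE g. \<psi> f = embed g)" for f
  have phi_eq: "\<phi> f = g" if "\<psi> f = embed g" for f g
    unfolding \<phi>_def using that by (intro the_equality) auto
  have phi: "\<phi> f \<in> carrier (sym_z n k)" "embed (\<phi> f) = \<psi> f" if "f \<in> carrier (sym_zw n k)" for f
    using range[OF that] phi_eq by auto
  have "\<phi> \<in> ring_hom (sym_zw n k) (sym_z n k)"
  proof (rule ring_hom_memI)
    fix f g assume fg: "f \<in> carrier (sym_zw n k)" "g \<in> carrier (sym_zw n k)"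
    have "\<phi> (f * g) = \<phi> f * \<phi> g" "\<phi> (f + g) = \<phi> f + \<phi> g"
      using phi(2)[OF fg(1)] phi(2)[OF fg(2)]
      by (auto intro!: phi_eq simp: psi.mult embed.mult psi.add embed.add)
    then show "\<phi> (f \<otimes>\<^bsub>sym_zw n k\<^esub> g) = \<phi> f \<otimes>\<^bsub>sym_z n k\<^esub> \<phi> g"
      "\<phi> (f \<oplus>\<^bsub>sym_zw n k\<^esub> g) = \<phi> f \<oplus>\<^bsub>sym_z n k\<^esub> \<phi> g"
      by (simp_all add: sym_zw_def sym_z_def)
  next
    show "\<phi> \<one>\<^bsub>sym_zw n k\<^esub> = \<one>\<^bsub>sym_z n k\<^esub>"
      using phi_eq[of 1 1] by (simp add: sym_zw_def sym_z_def psi.one embed.one)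
  qed (rule phi(1))
  moreover have "\<phi> f = f" if "f \<in> carrier (sym_z n k)" for f
    by (rule phi_eq) (rule psi_sym_z[OF that])
  moreover have "\<phi> (esym (n - k) w (int j)) = c j" if "j \<le> n - k" for j
    by (rule phi_eq) (rule psi_w[OF that])
  ultimately show ?thesis by blast
qed

section \<open>Quotients and retractions\<close>

text \<open>The composite of \<open>\<phi>\<close> with the projection to the quotient of \<open>S\<close> is onto because \<open>\<phi>\<close> is a
  retraction. If it maps \<open>f\<close> to zero, then \<open>\<phi> f\<close> lies in the ideal generated by \<open>B\<close>, hence in the
  one generated by \<open>A\<close>, and so does \<open>f = (f - \<phi> f) + \<phi> f\<close>.\<close>
lemma quotient_iso_of_retraction:
  assumes R: "cring R" and S: "cring S"
    and hom: "\<phi> \<in> ring_hom R S"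
    and incl: "id \<in> ring_hom S R"
    and retract: "\<And>f. f \<in> carrier S \<Longrightarrow> \<phi> f = f"
    and A: "A \<subseteq> carrier R" and B: "B \<subseteq> carrier S"
    and AB: "\<And>a. a \<in> A \<Longrightarrow> \<phi> a \<in> Idl\<^bsub>S\<^esub> B" and BA: "B \<subseteq> Idl\<^bsub>R\<^esub> A"
    and congr: "\<And>f. f \<in> carrier R \<Longrightarrow> f \<ominus>\<^bsub>R\<^esub> \<phi> f \<in> Idl\<^bsub>R\<^esub> A"
  shows "R Quot (Idl\<^bsub>R\<^esub> A) \<simeq> S Quot (Idl\<^bsub>S\<^esub> B)"
proof -
  interpret R: cring R by (rule R)
  interpret S: cring S by (rule S)
  interpret phi: ring_hom_ring R S \<phi>
    by (intro ring_hom_ringI2 R.ring_axioms S.ring_axioms hom)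
  interpret incl: ring_hom_ring S R id
    by (intro ring_hom_ringI2 R.ring_axioms S.ring_axioms incl)
  interpret I: ideal "Idl\<^bsub>R\<^esub> A" R by (rule R.genideal_ideal[OF A])
  interpret J: ideal "Idl\<^bsub>S\<^esub> B" S by (rule S.genideal_ideal[OF B])
  define h where "h = a_r_coset S (Idl\<^bsub>S\<^esub> B) \<circ> \<phi>"
  have hom_h: "h \<in> ring_hom R (S Quot (Idl\<^bsub>S\<^esub> B))"
    unfolding h_def by (rule ring_hom_trans[OF hom J.rcos_ring_hom])
  interpret h: ring_hom_ring R "S Quot (Idl\<^bsub>S\<^esub> B)" h
    by (intro ring_hom_ringI2 R.ring_axioms J.quotient_is_ring hom_h)
  have in_R: "f \<in> carrier R" if "f \<in> carrier S" for f
    using incl.hom_closed[OF that] by simp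
  have surj: "h ` carrier R = carrier (S Quot (Idl\<^bsub>S\<^esub> B))"
  proof
    show "h ` carrier R \<subseteq> carrier (S Quot (Idl\<^bsub>S\<^esub> B))"
      using h.hom_closed by blast
    show "carrier (S Quot (Idl\<^bsub>S\<^esub> B)) \<subseteq> h ` carrier R"
    proof
      fix U assume "U \<in> carrier (S Quot (Idl\<^bsub>S\<^esub> B))"
      then obtain g where g: "g \<in> carrier S" "U = Idl\<^bsub>S\<^esub> B +>\<^bsub>S\<^esub> g"
        by (auto simp: FactRing_def A_RCOSETS_def')
      then have "U = h g" by (simp add: h_def retract)
      with g in_R show "U \<in> h ` carrier R" by blast
    qed
  qed
  have ker: "a_kernel R (S Quot (Idl\<^bsub>S\<^esub> B)) h = {f \<in> carrier R. \<phi> f \<in> Idl\<^bsub>S\<^esub> B}"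
  proof -
    have coset: "Idl\<^bsub>S\<^esub> B +>\<^bsub>S\<^esub> g = Idl\<^bsub>S\<^esub> B \<longleftrightarrow> g \<in> Idl\<^bsub>S\<^esub> B"
      if "g \<in> carrier S" for g
      using J.rcos_const_imp_mem[OF that] S.a_rcos_zero[OF J.is_ideal, of g] by iprover
    have zero: "\<zero>\<^bsub>S Quot (Idl\<^bsub>S\<^esub> B)\<^esub> = Idl\<^bsub>S\<^esub> B"
      by (simp add: FactRing_def)
    show ?thesis
      unfolding a_kernel_def' zero h_def o_apply using coset[OF phi.hom_closed] by blast
  qed
  have J_sub_I: "Idl\<^bsub>S\<^esub> B \<subseteq> Idl\<^bsub>R\<^esub> A"
  proof -
    have "ideal {g \<in> carrier S. id g \<in> Idl\<^bsub>R\<^esub> A} S"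
      by (rule incl.ideal_vimage[OF I.is_ideal])
    then have "Idl\<^bsub>S\<^esub> B \<subseteq> {g \<in> carrier S. id g \<in> Idl\<^bsub>R\<^esub> A}"
      by (rule S.genideal_minimal) (use B BA in auto)
    then show ?thesis by auto
  qed
  have "{f \<in> carrier R. \<phi> f \<in> Idl\<^bsub>S\<^esub> B} = Idl\<^bsub>R\<^esub> A"
  proof
    show "Idl\<^bsub>R\<^esub> A \<subseteq> {f \<in> carrier R. \<phi> f \<in> Idl\<^bsub>S\<^esub> B}"
      by (rule R.genideal_minimal[OF phi.ideal_vimage[OF J.is_ideal]]) (use A AB in auto)
    show "{f \<in> carrier R. \<phi> f \<in> Idl\<^bsub>S\<^esub> B} \<subseteq> Idl\<^bsub>R\<^esub> A"
    proof safe
      fix f assume f: "f \<in> carrier R" "\<phi> f \<in> Idl\<^bsub>S\<^esub> B"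
      have "\<phi> f \<in> carrier R" using f(1) in_R by simp
      have "(f \<ominus>\<^bsub>R\<^esub> \<phi> f) \<oplus>\<^bsub>R\<^esub> \<phi> f \<in> Idl\<^bsub>R\<^esub> A"
        using congr[OF f(1)] f(2) J_sub_I by (intro I.a_closed) auto
      with f(1) \<open>\<phi> f \<in> carrier R\<close> show "f \<in> Idl\<^bsub>R\<^esub> A"
        by (simp add: a_minus_def R.a_assoc R.l_neg)
    qed
  qed
  with h.FactRing_iso[OF surj] ker show ?thesis by simp
qed

section \<open>Equivariant convolution identities\<close>

text \<open>Associativity of the Cauchy product. It reduces the equivariant identities, in which \<open>u\<close> is the
  sequence of the \<open>e\<^sub>a(\<zeta>)\<close>, to the identities for \<open>h\<close> and \<open>G\<close>.\<close>
lemma convolution_assoc: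
  fixes u v e D :: "nat \<Rightarrow> 'a::comm_ring_1"
  assumes "\<And>l. (\<Sum>i=0..l. e (l - i) * v i) = D l"
  shows "(\<Sum>i=0..l. e i * (\<Sum>a=0..l - i. u a * v (l - i - a))) = (\<Sum>a=0..l. u a * D (l - a))"
proof -
  have "Abs_fps v * Abs_fps e = Abs_fps D"
  proof (rule fps_ext)
    show "fps_nth (Abs_fps v * Abs_fps e) m = fps_nth (Abs_fps D) m" for m
      unfolding fps_mult_nth assms[symmetric] fps_nth_Abs_fps by (simp only: mult.commute)
  qed
  then have "Abs_fps e * (Abs_fps u * Abs_fps v) = Abs_fps u * Abs_fps D"
    by (metis mult.assoc mult.commute)
  then have "fps_nth (Abs_fps e * (Abs_fps u * Abs_fps v)) l = fps_nth (Abs_fps u * Abs_fps D) l"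
    by simp
  then show ?thesis by (simp add: fps_mult_nth)
qed

lemma signed_convolution:
  fixes u v :: "nat \<Rightarrow> 'a::comm_ring_1"
  shows "(-1) ^ j * (\<Sum>a=0..j. (-1) ^ a * u a * v (j - a))
     = (\<Sum>a=0..j. u a * ((-1) ^ (j - a) * v (j - a)))"
  unfolding sum_distrib_left
proof (rule sum.cong)
  fix a assume "a \<in> {0..j}"
  then have "(-1) ^ j = ((-1) ^ (j - a) * (-1) ^ a :: 'a)"
    by (simp flip: power_add)
  then show "(-1) ^ j * ((-1) ^ a * u a * v (j - a)) = u a * ((-1) ^ (j - a) * v (j - a))"
    by (simp add: mult_ac)
qed simp

lemma esym_h'_convolution:
  "(\<Sum>i=0..l. esym k z (int i) * ((-1) ^ (l - i) * h' n k (l - i))) = esym n \<zeta> (int l)"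
proof -
  have "(\<Sum>i=0..l. esym k z (int i) * ((-1) ^ (l - i) * h' n k (l - i)))
      = (\<Sum>a=0..l. esym n \<zeta> (int a) * (if l - a = 0 then 1 else 0))"
    unfolding h'_def signed_convolution[of _ "\<lambda>a. esym n \<zeta> (int a)" "hsym k z"]
    by (rule convolution_assoc[OF esym_hsym_convolution])
  also have "\<dots> = (\<Sum>a=0..l. if a = l then esym n \<zeta> (int a) else 0)"
    by (rule sum.cong) auto
  finally show ?thesis by simp
qed

lemma esym_G'_convolution:
  "(\<Sum>i=0..l. esym k z (int i) * ((-1) ^ (l - i) * G' n k (l - i))) = c' n k l"
proof -
  let ?t = "\<lambda>s. esym n \<zeta> (int l - int s + 1) * c_ge k z s"
  have "(\<Sum>i=0..l. esym k z (int i) * ((-1) ^ (l - i) * G' n k (l - i)))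
      = (\<Sum>a=0..l. esym n \<zeta> (int a) * (if l - a = 0 then 1 else c_ge k z (Suc (l - a))))"
    unfolding G'_def signed_convolution[of _ "\<lambda>a. esym n \<zeta> (int a)" "grothendieck k z"]
    by (rule convolution_assoc[OF esym_grothendieck_convolution])
  also have "\<dots> = esym n \<zeta> (int l) + (\<Sum>a<l. esym n \<zeta> (int a) * c_ge k z (Suc (l - a)))"
    by (simp add: atLeast0AtMost flip: lessThan_Suc_atMost)
  also have "(\<Sum>a<l. esym n \<zeta> (int a) * c_ge k z (Suc (l - a))) = (\<Sum>s=2..Suc l. ?t s)"
    by (rule sum.reindex_bij_witness[of _ "\<lambda>s. Suc l - s" "\<lambda>a. Suc l - a"])
       (auto simp: of_nat_diff Suc_diff_le)
  \<comment> \<open>Both sums extend to a common range: \<open>e\<^bsub>l-s+1\<^esub>(\<zeta>) = 0\<close> for \<open>s > l + 1\<close>, and the tail \<open>c_ge\<close> is empty for \<open>s > k\<close>.\<close>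
  also have "\<dots> = (\<Sum>s=2..max k (Suc l). ?t s)"
    by (rule sum.mono_neutral_left) auto
  also have "\<dots> = (\<Sum>s=2..k. ?t s)"
    by (rule sum.mono_neutral_right) (auto simp: c_ge_def)
  finally show ?thesis by (simp add: c'_def)
qed

section \<open>Elimination of the second set of variables\<close>

text \<open>Replacing \<open>P\<^sub>d\<close> by \<open>0\<close> for \<open>d > m\<close> removes from the convolution of degree \<open>m + i\<close> the terms
  \<open>e\<^bsub>i-s\<^esub> P\<^bsub>m+s\<^esub>\<close> with \<open>1 \<le> s \<le> i\<close>, and \<open>- e\<^bsub>i-s\<^esub>\<close> is the \<open>(i, s)\<close> entry of \<open>E\<close>.\<close>
lemma truncated_convolution:
  assumes conv: "\<And>l. (\<Sum>i=0..l. esym k z (int i) * P (l - i)) = c l"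
    and "i \<le> k"
  shows "(\<Sum>j=0..m + i. esym k z (int j) * (if m + i - j \<le> m then P (m + i - j) else 0))
     = c (m + i) + mat_vec k (E k) (\<lambda>s. P (m + s)) i"
proof -
  let ?t = "\<lambda>j. esym k z (int j) * P (m + i - j)"
  have "(\<Sum>j=0..m + i. esym k z (int j) * (if m + i - j \<le> m then P (m + i - j) else 0))
      = (\<Sum>j=0..m + i. ?t j - (if j < i then ?t j else 0))"
    by (rule sum.cong) auto
  also have "\<dots> = c (m + i) - (\<Sum>j | j \<in> {0..m + i} \<and> j < i. ?t j)"
    unfolding sum_subtractf conv by (subst sum.inter_filter) auto
  also have "(\<Sum>j | j \<in> {0..m + i} \<and> j < i. ?t j) = (\<Sum>s | s \<in> {1..k} \<and> s \<le> i. ?t (i - s))"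
    by (rule sum.reindex_bij_witness[of _ "\<lambda>s. i - s" "\<lambda>j. i - j"]) (use \<open>i \<le> k\<close> in auto)
  also have "\<dots> = (\<Sum>s=1..k. if s \<le> i then ?t (i - s) else 0)"
    by (rule sum.inter_filter) simp
  also have "\<dots> = - mat_vec k (E k) (\<lambda>s. P (m + s)) i"
    unfolding mat_vec_def sum_negf[symmetric] by (rule sum.cong) (auto simp: E_def of_nat_diff)
  finally show ?thesis by simp
qed

lemma ideal_adjoin:
  assumes "ideal I (adjoin n S)"
  shows ideal_adjoin_0: "0 \<in> I"
    and ideal_adjoin_add: "x \<in> I \<Longrightarrow> y \<in> I \<Longrightarrow> x + y \<in> I"
    and ideal_adjoin_minus: "x \<in> I \<Longrightarrow> - x \<in> I"
    and ideal_adjoin_mult: "a \<in> carrier (adjoin n S) \<Longrightarrow> x \<in> I \<Longrightarrow> a * x \<in> I"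
proof -
  interpret ideal I "adjoin n S" by (rule assms)
  show "0 \<in> I" using additive_subgroup.zero_closed[OF is_additive_subgroup] by simp
  show "x + y \<in> I" if "x \<in> I" "y \<in> I"
    using additive_subgroup.a_closed[OF is_additive_subgroup that] by simp
  show mult: "a * x \<in> I" if "a \<in> carrier (adjoin n S)" "x \<in> I" for a x
    using I_l_closed[OF that(2,1)] by simp
  show "- x \<in> I" if "x \<in> I"
    using mult[OF adjoin_minus[OF adjoin_1] that] by simp
qed

lemma ideal_adjoin_sum:
  assumes "ideal I (adjoin n S)" "\<And>i. i \<in> A \<Longrightarrow> f i \<in> I"
  shows "(\<Sum>i\<in>A. f i) \<in> I"
  using assms(2)
  by (induction A rule: infinite_finite_induct)
     (simp_all add: ideal_adjoin_0[OF assms(1)] ideal_adjoin_add[OF assms(1)])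

lemma ring_hom_adjoin:
  assumes "\<phi> \<in> ring_hom (adjoin n S) (adjoin n' S')"
  shows ring_hom_adjoin_add: "x \<in> carrier (adjoin n S) \<Longrightarrow> y \<in> carrier (adjoin n S) \<Longrightarrow> \<phi> (x + y) = \<phi> x + \<phi> y"
    and ring_hom_adjoin_mult: "x \<in> carrier (adjoin n S) \<Longrightarrow> y \<in> carrier (adjoin n S) \<Longrightarrow> \<phi> (x * y) = \<phi> x * \<phi> y"
    and ring_hom_adjoin_0: "\<phi> 0 = 0"
    and ring_hom_adjoin_1: "\<phi> 1 = 1"
    and ring_hom_adjoin_minus: "x \<in> carrier (adjoin n S) \<Longrightarrow> \<phi> (- x) = - \<phi> x"
    and ring_hom_adjoin_diff: "x \<in> carrier (adjoin n S) \<Longrightarrow> y \<in> carrier (adjoin n S) \<Longrightarrow> \<phi> (x - y) = \<phi> x - \<phi> y"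
proof -
  show add: "\<phi> (x + y) = \<phi> x + \<phi> y"
    if "x \<in> carrier (adjoin n S)" "y \<in> carrier (adjoin n S)" for x y
    using ring_hom_add[OF assms that] by simp
  show "\<phi> (x * y) = \<phi> x * \<phi> y"
    if "x \<in> carrier (adjoin n S)" "y \<in> carrier (adjoin n S)"
    using ring_hom_mult[OF assms that] by simp
  show zero: "\<phi> 0 = 0" using add[OF adjoin_0 adjoin_0] by simp
  show "\<phi> 1 = 1" using ring_hom_one[OF assms] by simp
  show minus: "\<phi> (- x) = - \<phi> x" if "x \<in> carrier (adjoin n S)" for x
    using add[OF that adjoin_minus[OF that]] zero by (simp add: eq_neg_iff_add_eq_0 add.commute)
  show "\<phi> (x - y) = \<phi> x - \<phi> y"
    if "x \<in> carrier (adjoin n S)" "y \<in> carrier (adjoin n S)"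
    using add[OF that(1) adjoin_minus[OF that(2)]] minus[OF that(2)] by simp
qed

lemma ring_hom_adjoin_sum:
  assumes "\<phi> \<in> ring_hom (adjoin n S) (adjoin n' S')" "\<And>i. i \<in> A \<Longrightarrow> f i \<in> carrier (adjoin n S)"
  shows "\<phi> (\<Sum>i\<in>A. f i) = (\<Sum>i\<in>A. \<phi> (f i))"
  using assms(2)
  by (induction A rule: infinite_finite_induct)
     (simp_all add: ring_hom_adjoin_0[OF assms(1)] ring_hom_adjoin_add[OF assms(1)] adjoin_sum)

definition specialisation :: "nat \<Rightarrow> nat \<Rightarrow> (nat \<Rightarrow> pol) \<Rightarrow> (pol \<Rightarrow> pol) \<Rightarrow> bool" where
  "specialisation n k P \<phi> \<longleftrightarrow> \<phi> \<in> ring_hom (sym_zw n k) (sym_z n k) \<and>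
     (\<forall>f\<in>carrier (sym_z n k). \<phi> f = f) \<and> (\<forall>j\<le>n - k. \<phi> (esym (n - k) w (int j)) = P j)"

text \<open>The sequence \<open>P\<close> solves the first \<open>n - k\<close> relations, in which the right-hand side \<open>g l\<close> equals
  \<open>c l\<close>. The element \<open>g' l\<close> is the value of \<open>g l\<close> after the specialisation \<open>e\<^sub>j(w) \<mapsto> P\<^sub>j\<close>. The
  specialisation sends the first \<open>n - k\<close> relations to \<open>0\<close> and the others, up to sign, to the relations
  on the right; and it does not change classes modulo the relations, as it suffices to check
  on the generators \<open>e\<^sub>j(w)\<close>.\<close>
lemma eliminate_w_variables:
  assumes "k < n"
    and P: "\<And>j. P j \<in> carrier (sym_z n k)" "P 0 = 1"
    and conv: "\<And>l. (\<Sum>i=0..l. esym k z (int i) * P (l - i)) = c l"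
    and g: "\<And>l. g l \<in> carrier (sym_zw n k)" "\<And>l. l \<le> n - k \<Longrightarrow> g l = c l"
    and spec_g: "\<And>\<phi> l. specialisation n k P \<phi> \<Longrightarrow> \<phi> (g l) = g' l"
  shows "ring_mod (sym_zw n k)
       {(\<Sum>i=0..l. esym k z (int i) * esym (n - k) w (int (l - i))) - g l | l. l \<in> {1..n}}
     \<simeq> ring_mod (sym_z n k)
       {g' (n - k + i) - (mat_vec k (E k) (\<lambda>s. P (n - k + s)) i + c (n - k + i)) | i. i \<in> {1..k}}"
proof -
  obtain \<phi> where spec: "specialisation n k P \<phi>"
    using exists_specialisation[of P n k] P unfolding specialisation_def by blast
  then have hom: "\<phi> \<in> ring_hom (sym_zw n k) (sym_z n k)"
    and retract: "\<And>f. f \<in> carrier (sym_z n k) \<Longrightarrow> \<phi> f = f"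
    and phi_w: "\<And>j. j \<le> n - k \<Longrightarrow> \<phi> (esym (n - k) w (int j)) = P j"
    by (auto simp: specialisation_def)
  note hom' = hom[unfolded sym_zw_def sym_z_def]
  note zw_closed = adjoin_closed[where n = n and
      S = "{esym k z (int i) | i. i \<in> {1..k}} \<union> {esym (n - k) w (int j) | j. j \<in> {1..n - k}}",
      folded sym_zw_def]
  note zw_induct = adjoin_induct[where n = n and
      S = "{esym k z (int i) | i. i \<in> {1..k}} \<union> {esym (n - k) w (int j) | j. j \<in> {1..n - k}}",
      folded sym_zw_def, consumes 1, case_names const gen one minus add mult]
  note z_closed = adjoin_closed[where n = n and S = "{esym k z (int i) | i. i \<in> {1..k}}",
      folded sym_z_def]
  have z_zw: "x \<in> carrier (sym_zw n k)" if "x \<in> carrier (sym_z n k)" for x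
    using sym_z_subset that by blast
  have phi_closed: "\<phi> x \<in> carrier (sym_z n k)" if "x \<in> carrier (sym_zw n k)" for x
    by (rule ring_hom_closed[OF hom that])
  have c_mem: "c l \<in> carrier (sym_z n k)" for l
    unfolding conv[symmetric] by (intro z_closed esym_z_mem P)
  define a where "a l = (\<Sum>i=0..l. esym k z (int i) * esym (n - k) w (int (l - i))) - g l" for l
  define b where "b i = g' (n - k + i) -
      (mat_vec k (E k) (\<lambda>s. P (n - k + s)) i + c (n - k + i))" for i
  define A where "A = {a l | l. l \<in> {1..n}}"
  define B where "B = {b i | i. i \<in> {1..k}}"
  have a_mem: "a l \<in> carrier (sym_zw n k)" for l
    unfolding a_def by (intro zw_closed z_zw[OF esym_z_mem] esym_w_mem g)
  have A: "A \<subseteq> carrier (sym_zw n k)" using a_mem by (auto simp: A_def)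
  have phi_w': "\<phi> (esym (n - k) w (int d)) = (if d \<le> n - k then P d else 0)" for d
    using phi_w ring_hom_adjoin_0[OF hom'] by (auto simp: esym_above)
  have phi_a: "\<phi> (a l) =
      (\<Sum>j=0..l. esym k z (int j) * (if l - j \<le> n - k then P (l - j) else 0)) - g' l" for l
  proof -
    have "\<phi> (esym k z (int j) * esym (n - k) w (int (l - j)))
        = esym k z (int j) * (if l - j \<le> n - k then P (l - j) else 0)" for j
      by (simp only: ring_hom_adjoin_mult[OF hom', folded sym_zw_def, OF z_zw[OF esym_z_mem] esym_w_mem]
        retract[OF esym_z_mem] phi_w')
    moreover have "\<phi> (a l) =
        (\<Sum>j=0..l. \<phi> (esym k z (int j) * esym (n - k) w (int (l - j)))) - \<phi> (g l)"
      unfolding a_def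
      by (subst ring_hom_adjoin_diff[OF hom', folded sym_zw_def]
          ring_hom_adjoin_sum[OF hom', folded sym_zw_def];
          (intro zw_closed z_zw[OF esym_z_mem] esym_w_mem g)?)+ simp
    ultimately show ?thesis by (simp only: spec_g[OF spec])
  qed
  have phi_a_low: "\<phi> (a l) = 0" if "l \<le> n - k" for l
  proof -
    have "g' l = c l"
      using spec_g[OF spec, of l] g(2)[OF that] retract[OF c_mem] by simp
    moreover have "(\<Sum>j=0..l. esym k z (int j) * (if l - j \<le> n - k then P (l - j) else 0)) = c l"
      unfolding conv[symmetric] by (rule sum.cong) (use that in auto)
    ultimately show ?thesis by (simp add: phi_a)
  qed
  have phi_a_high: "\<phi> (a (n - k + i)) = - b i" if "i \<le> k" for i
    unfolding phi_a truncated_convolution[OF conv that] b_def by simp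
  have b_mem: "b i \<in> carrier (sym_z n k)" if "i \<le> k" for i
    using phi_closed[OF a_mem] z_closed(3) phi_a_high[OF that] by (metis minus_minus)
  have B: "B \<subseteq> carrier (sym_z n k)" using b_mem by (auto simp: B_def)
  let ?I = "Idl\<^bsub>sym_zw n k\<^esub> A" and ?J = "Idl\<^bsub>sym_z n k\<^esub> B"
  interpret zw: cring "sym_zw n k" unfolding sym_zw_def by (rule cring_adjoin)
  interpret zr: cring "sym_z n k" unfolding sym_z_def by (rule cring_adjoin)
  have idI: "ideal ?I (sym_zw n k)" by (rule zw.genideal_ideal[OF A])
  have idJ: "ideal ?J (sym_z n k)" by (rule zr.genideal_ideal[OF B])
  note I_closed = ideal_adjoin[OF idI[unfolded sym_zw_def], folded sym_zw_def]
  note I_sum = ideal_adjoin_sum[OF idI[unfolded sym_zw_def], folded sym_zw_def]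
  note J_closed = ideal_adjoin[OF idJ[unfolded sym_z_def], folded sym_z_def]
  have a_I: "a l \<in> ?I" if "l \<in> {1..n}" for l
    using zw.genideal_self[OF A] that by (auto simp: A_def)
  \<comment> \<open>The relation of degree \<open>j\<close> minus the identity \<open>conv\<close> is a combination of the differences
    \<open>e\<^sub>i(w) - P\<^sub>i\<close> with \<open>i \<le> j\<close>, in which the one for \<open>i = j\<close> has coefficient \<open>e\<^sub>0(z) = 1\<close>.\<close>
  have congr_w: "esym (n - k) w (int j) - P j \<in> ?I" if "j \<le> n - k" for j
    using that
  proof (induction j rule: less_induct)
    case (less j)
    show ?case
    proof (cases j)
      case 0
      then show ?thesis using I_closed(1) P(2) by simp
    next
      case (Suc r)
      let ?d = "\<lambda>i. esym (n - k) w (int i) - P i"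
      have "a j = (\<Sum>i=0..j. esym k z (int i) * esym (n - k) w (int (j - i)))
          - (\<Sum>i=0..j. esym k z (int i) * P (j - i))"
        unfolding conv a_def g(2)[OF less.prems] ..
      also have "\<dots> = (\<Sum>i=0..j. esym k z (int i) * ?d (j - i))"
        by (simp add: right_diff_distrib sum_subtractf)
      also have "\<dots> = ?d j + (\<Sum>i=1..j. esym k z (int i) * ?d (j - i))"
        by (simp add: sum.atLeast_Suc_atMost)
      finally have eq: "?d j = a j + - (\<Sum>i=1..j. esym k z (int i) * ?d (j - i))"
        by simp
      have "(\<Sum>i=1..j. esym k z (int i) * ?d (j - i)) \<in> ?I"
        by (intro I_sum I_closed(4) z_zw[OF esym_z_mem] less.IH) (use less.prems in auto)
      moreover have "a j \<in> ?I" using less.prems Suc by (intro a_I) auto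
      ultimately show ?thesis unfolding eq by (intro I_closed(2,3))
    qed
  qed
  have congr: "f - \<phi> f \<in> ?I" if "f \<in> carrier (sym_zw n k)" for f
    using that
  proof (induction rule: zw_induct)
    case (const d)
    then have "const d \<in> carrier (sym_z n k)" unfolding sym_z_def by (rule adjoin_const)
    then show ?case using retract I_closed(1) by simp
  next
    case (gen s)
    then show ?case
      using retract[OF esym_z_mem] I_closed(1) congr_w phi_w by auto
  next
    case one
    then show ?case using ring_hom_adjoin_1[OF hom'] I_closed(1) by simp
  next
    case (minus f)
    have eq: "- f - \<phi> (- f) = - (f - \<phi> f)"
      using ring_hom_adjoin_minus[OF hom', folded sym_zw_def, OF minus(1)] by simp
    show ?case unfolding eq by (rule I_closed(3)[OF minus(2)])
  next
    case (add f g)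
    have eq: "f + g - \<phi> (f + g) = (f - \<phi> f) + (g - \<phi> g)"
      using ring_hom_adjoin_add[OF hom', folded sym_zw_def, OF add(1,2)] by simp
    show ?case unfolding eq by (rule I_closed(2)[OF add(3,4)])
  next
    case (mult f g)
    have eq: "f * g - \<phi> (f * g) = f * (g - \<phi> g) + \<phi> g * (f - \<phi> f)"
      using ring_hom_adjoin_mult[OF hom', folded sym_zw_def, OF mult(1,2)]
      by (simp add: algebra_simps)
    show ?case unfolding eq by (intro I_closed(2,4) mult z_zw phi_closed)
  qed
  have "sym_zw n k Quot ?I \<simeq> sym_z n k Quot ?J"
  proof (rule quotient_iso_of_retraction[OF zw.is_cring zr.is_cring hom _ retract A B])
    show "id \<in> ring_hom (sym_z n k) (sym_zw n k)"
      by (rule ring_hom_memI) (auto simp: z_zw, simp_all add: sym_z_def sym_zw_def)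
    show "\<phi> x \<in> ?J" if "x \<in> A" for x
    proof -
      from that obtain l where l: "x = a l" "1 \<le> l" "l \<le> n" by (auto simp: A_def)
      show ?thesis
      proof (cases "l \<le> n - k")
        case True
        then show ?thesis using l phi_a_low J_closed(1) by simp
      next
        case False
        define i where "i = l - (n - k)"
        have i: "l = n - k + i" "i \<in> {1..k}" using False l \<open>k < n\<close> by (auto simp: i_def)
        then have "b i \<in> ?J" using zr.genideal_self[OF B] by (auto simp: B_def)
        then show ?thesis using i l phi_a_high J_closed(3) by simp
      qed
    qed
    show "B \<subseteq> ?I"
    proof
      fix y assume "y \<in> B"
      then obtain i where i: "y = b i" "i \<in> {1..k}" by (auto simp: B_def)
      have eq: "y = (a (n - k + i) - \<phi> (a (n - k + i))) + - a (n - k + i)"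
        using i phi_a_high by simp
      show "y \<in> ?I"
        unfolding eq using i \<open>k < n\<close> by (intro I_closed(2,3) congr a_mem a_I) auto
    qed
    show "f \<ominus>\<^bsub>sym_zw n k\<^esub> \<phi> f \<in> ?I" if "f \<in> carrier (sym_zw n k)" for f
    proof -
      have "f \<ominus>\<^bsub>sym_zw n k\<^esub> \<phi> f = f - \<phi> f"
        using z_zw[OF phi_closed[OF that]] by (simp add: a_minus_def sym_zw_def)
      then show ?thesis using congr[OF that] by simp
    qed
  qed
  then show ?thesis by (simp add: ring_mod_def A_def B_def a_def b_def)
qed

lemma esym_zeta_mem: "esym n \<zeta> d \<in> carrier (adjoin n S)"
  by (intro esym_mem zeta_mem)

lemma c'_mem: "c' n k l \<in> carrier (sym_z n k)"
  using esym_z_mem[of k _ n] unfolding c'_def sym_z_def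
  by (intro adjoin_closed esym_zeta_mem c_ge_mem)

lemma h'_mem: "h' n k j \<in> carrier (sym_z n k)"
  using esym_z_mem[of k _ n] unfolding h'_def sym_z_def
  by (intro adjoin_closed esym_zeta_mem hsym_mem)

lemma G'_mem: "G' n k j \<in> carrier (sym_z n k)"
  using esym_z_mem[of k _ n] unfolding G'_def sym_z_def
  by (intro adjoin_closed esym_zeta_mem grothendieck_mem)

lemma g_hat_mem: "g_hat n k l \<in> carrier (sym_z n k)"
proof -
  have "mat_vec k (E k) (C_zeta n k) i \<in> carrier (sym_z n k)" for i
    using esym_z_mem[of k _ n] adjoin_0 adjoin_minus c_ge_mem[OF esym_zeta_mem]
    unfolding mat_vec_def E_def C_zeta_def sym_z_def
    by (intro adjoin_sum adjoin_mult) (auto split: if_splits)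
  moreover have "(\<Prod>i=1..n. 1 - \<zeta> i) \<in> carrier (sym_z n k)"
    unfolding sym_z_def by (intro adjoin_prod adjoin_diff adjoin_1 zeta_mem)
  ultimately show ?thesis
    using c'_mem[of n k l] q_mem unfolding g_hat_def sym_z_def
    by (auto intro!: adjoin_add adjoin_mult adjoin_power adjoin_minus adjoin_1 adjoin_of_nat)
qed

section \<open>The two presentations\<close>

text \<open>For \<open>l = n - k\<close> the binomial coefficient and \<open>e\<^sub>0(z)\<close> are both \<open>1\<close> and cancel; for smaller \<open>l\<close>
  both vanish.\<close>
lemma g_tilde_low:
  assumes "k \<le> n" "l \<le> n - k"
  shows "g_tilde n k u l = esym n \<zeta> (int l)"
proof (cases "l + k < n")
  case True
  then have "esym k z (int l + int k - int n) = 0" by (intro esym_neg) linarith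
  with True show ?thesis by (simp add: g_tilde_def)
next
  case False
  with assms have n: "n = l + k" by linarith
  show ?thesis by (simp add: g_tilde_def n)
qed

lemma g_tilde_mem:
  assumes "u \<in> carrier (adjoin n S)" "\<And>d. esym k z d \<in> carrier (adjoin n S)"
  shows "g_tilde n k u l \<in> carrier (adjoin n S)"
  unfolding g_tilde_def
  by (intro adjoin_add adjoin_mult adjoin_diff adjoin_power adjoin_minus adjoin_1 esym_zeta_mem
      q_over_one_minus_q_mem assms) (simp add: adjoin_0 adjoin_of_nat)

text \<open>As a function of its argument \<open>u\<close>, \<open>g_tilde\<close> is affine with coefficients in \<open>sym_z n k\<close>, so
  only \<open>u = \<Prod>\<^sub>j (1 - w\<^sub>j) = \<Sum>\<^sub>j (-1)\<^sup>j e\<^sub>j(w)\<close> is affected.\<close>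
lemma specialisation_g_tilde:
  assumes "specialisation n k P \<phi>"
  shows "\<phi> (g_tilde n k (esym (n - k) (\<lambda>j. 1 - w j) (int (n - k))) l)
     = g_tilde n k (\<Sum>j=0..n - k. (-1) ^ j * P j) l"
proof -
  from assms have hom: "\<phi> \<in> ring_hom (sym_zw n k) (sym_z n k)"
    and retract: "\<And>f. f \<in> carrier (sym_z n k) \<Longrightarrow> \<phi> f = f"
    and phi_w: "\<And>j. j \<le> n - k \<Longrightarrow> \<phi> (esym (n - k) w (int j)) = P j"
    by (auto simp: specialisation_def)
  note hom = hom[unfolded sym_zw_def sym_z_def]
  let ?u = "\<Sum>j=0..n - k. (-1) ^ j * esym (n - k) w (int j)"
  define s where "s = (-1) ^ (n - k) * q_over_one_minus_q *
     ((if l + k < n then 0 else of_nat (k choose (l + k - n))) - esym k z (int l + int k - int n))"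
  have s_mem: "s \<in> carrier (sym_z n k)"
    using esym_z_mem[of k _ n] unfolding s_def sym_z_def
    by (intro adjoin_mult adjoin_diff adjoin_power adjoin_minus adjoin_1 q_over_one_minus_q_mem)
       (simp_all add: adjoin_0 adjoin_of_nat)
  have zeta_mem: "esym n \<zeta> (int l) \<in> carrier (sym_z n k)"
    unfolding sym_z_def by (rule esym_zeta_mem)
  have sign_mem: "(-1) ^ j \<in> carrier (sym_z n k)" for j
    unfolding sym_z_def by (intro adjoin_power adjoin_minus adjoin_1)
  note subset = subsetD[OF sym_z_subset[of n k], unfolded sym_zw_def]
  have w_mem: "(-1) ^ j * esym (n - k) w (int j) \<in> carrier (sym_zw n k)" for j
    unfolding sym_zw_def
    by (rule adjoin_mult[OF subset[OF sign_mem] esym_w_mem[unfolded sym_zw_def]])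
  have u_mem: "?u \<in> carrier (sym_zw n k)"
    using w_mem unfolding sym_zw_def by (intro adjoin_sum)
  have g: "g_tilde n k y l = esym n \<zeta> (int l) + s * y" for y
    by (simp add: g_tilde_def s_def mult_ac)
  have u: "esym (n - k) (\<lambda>j. 1 - w j) (int (n - k)) = ?u"
    by (simp only: esym_top prod_one_minus_eq_sum_esym)
  have "\<phi> (g_tilde n k ?u l) = esym n \<zeta> (int l) + s * \<phi> ?u"
    using ring_hom_adjoin_add[OF hom subset[OF zeta_mem] adjoin_mult[OF subset[OF s_mem] u_mem[unfolded sym_zw_def]]]
      ring_hom_adjoin_mult[OF hom subset[OF s_mem] u_mem[unfolded sym_zw_def]]
      retract[OF zeta_mem] retract[OF s_mem]
    unfolding g by metis
  also have "\<phi> ?u = (\<Sum>j=0..n - k. \<phi> ((-1) ^ j * esym (n - k) w (int j)))"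
    using w_mem unfolding sym_zw_def by (intro ring_hom_adjoin_sum[OF hom])
  also have "\<dots> = (\<Sum>j=0..n - k. (-1) ^ j * P j)"
  proof (rule sum.cong)
    fix j assume "j \<in> {0..n - k}"
    then show "\<phi> ((-1) ^ j * esym (n - k) w (int j)) = (-1) ^ j * P j"
      using ring_hom_adjoin_mult[OF hom subset[OF sign_mem] esym_w_mem[unfolded sym_zw_def]]
        retract[OF sign_mem] phi_w by simp
  qed simp
  finally show ?thesis by (simp only: u g)
qed

lemma h'_0: "h' n k 0 = 1"
  by (simp add: h'_def)

lemma G'_0: "G' n k 0 = 1"
  by (simp add: G'_def grothendieck_def)

lemma signed_mem:
  assumes "x \<in> carrier (sym_z n k)"
  shows "(-1) ^ j * x \<in> carrier (sym_z n k)"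
  using assms unfolding sym_z_def by (intro adjoin_mult adjoin_power adjoin_minus adjoin_1)

theorem theorem11p8:
  fixes n k :: nat
  assumes "0 < k" and "k < n"
  shows
    "QK_tilde n k \<simeq> ring_mod (sym_z n k)
       {g_tilde n k (\<Sum>j=0..n - k. h' n k j) (n - k + i)
        - (mat_vec k (E k) (\<lambda>s. (-1) ^ (n - k + s) * h' n k (n - k + s)) i
           + esym n \<zeta> (int (n - k + i))) | i. i \<in> {1..k}}
     \<and>
     QK_hat n k \<simeq> ring_mod (sym_z n k)
       {g_hat n k (n - k + i)
        - (mat_vec k (E k) (\<lambda>s. (-1) ^ (n - k + s) * G' n k (n - k + s)) i
           + c' n k (n - k + i)) | i. i \<in> {1..k}}"
proof
  let ?u = "esym (n - k) (\<lambda>j. 1 - w j) (int (n - k))"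
  have u_mem: "?u \<in> carrier (sym_zw n k)"
    using esym_w_mem[of n k] unfolding esym_top prod_one_minus_eq_sum_esym sym_zw_def
    by (intro adjoin_closed)
  show "QK_tilde n k \<simeq> ring_mod (sym_z n k)
       {g_tilde n k (\<Sum>j=0..n - k. h' n k j) (n - k + i)
        - (mat_vec k (E k) (\<lambda>s. (-1) ^ (n - k + s) * h' n k (n - k + s)) i
           + esym n \<zeta> (int (n - k + i))) | i. i \<in> {1..k}}"
    unfolding QK_tilde_def
  proof (rule eliminate_w_variables[OF \<open>k < n\<close>])
    show "g_tilde n k ?u l \<in> carrier (sym_zw n k)" for l
      using u_mem sym_z_subset esym_z_mem unfolding sym_zw_def by (intro g_tilde_mem) blast+
    show "g_tilde n k ?u l = esym n \<zeta> (int l)" if "l \<le> n - k" for l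
      using that \<open>k < n\<close> by (intro g_tilde_low) auto
    show "\<phi> (g_tilde n k ?u l) = g_tilde n k (\<Sum>j=0..n - k. h' n k j) l"
      if "specialisation n k (\<lambda>j. (-1) ^ j * h' n k j) \<phi>" for \<phi> l
      unfolding specialisation_g_tilde[OF that]
      by (simp flip: mult.assoc power_mult_distrib)
  qed (use esym_h'_convolution in \<open>auto simp: h'_0 intro: signed_mem h'_mem\<close>)
  show "QK_hat n k \<simeq> ring_mod (sym_z n k)
       {g_hat n k (n - k + i)
        - (mat_vec k (E k) (\<lambda>s. (-1) ^ (n - k + s) * G' n k (n - k + s)) i
           + c' n k (n - k + i)) | i. i \<in> {1..k}}"
    unfolding QK_hat_def
  proof (rule eliminate_w_variables[OF \<open>k < n\<close>])
    show "g_hat n k l \<in> carrier (sym_zw n k)" for l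
      using g_hat_mem sym_z_subset by blast
    show "g_hat n k l = c' n k l" if "l \<le> n - k" for l
      using that by (simp add: g_hat_def)
    show "\<phi> (g_hat n k l) = g_hat n k l"
      if "specialisation n k (\<lambda>j. (-1) ^ j * G' n k j) \<phi>" for \<phi> l
      using that g_hat_mem unfolding specialisation_def by blast
  qed (use esym_G'_convolution in \<open>auto simp: G'_0 intro: signed_mem G'_mem\<close>)
qed

end
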